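(* Let $n,m\ge1$ and let $p_{n,m}$ be stable of degree $n$ in $z$ and $m$ in $w$. In $L^2\!\left(\frac{d\sigma}{|p_{n,m}|^2}\right)$ define $$H_1=\operatorname{span}\{z^iw^j:0\le i\le n,0\le j\le m-1\}\ominus\operatorname{span}\{z^iw^j:0\le i\le n-1,0\le j\le m-1\},$$ $$\tilde H_2=\operatorname{span}\{z^iw^j:0\le i\le n-1,0\le j\le m\}\ominus\operatorname{span}\{z^iw^j:0\le i\le n-1,1\le j\le m\},$$ and let $K_1$, $K_2$ be their reproducing kernels. Then for all $(z,w),(z_1,w_1)\in\mathbb{C}^2$, $$p_{n,m}(z,w)\overline{p_{n,m}(z_1,w_1)}-\tilde p_{n,m}(z,w)\overline{\tilde p_{n,m}(z_1,w_1)}=(1-w\bar w_1)K_1(z,w;z_1,w_1)+(1-z\bar z_1)K_2(z,w;z_1,w_1).$$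
   Context: $\sigma$ is normalized Lebesgue measure on $\mathbb{T}^2$; $p_{n,m}$ is stable if it has no zeros in $\{|z|\le1,|w|\le1\}$. Inner product $\langle f,g\rangle=\int_{\mathbb{T}^2}f\bar g\,\frac{d\sigma}{|p_{n,m}|^2}$; $\ominus$ denotes orthogonal complement in this inner product. $\tilde p_{n,m}(z,w)=z^nw^m\overline{p_{n,m}(1/\bar z,1/\bar w)}$. The reproducing kernel of a finite-dimensional polynomial subspace $V$ with orthonormal basis $e_1,\dots,e_d$ is $K(z,w;z_1,w_1)=\sum_k e_k(z,w)\overline{e_k(z_1,w_1)}$. *)

theory Defs
  imports "HOL-Analysis.Analysis"
begin

text \<open>Bivariate polynomials are represented by coefficient functions
  c :: nat \<Rightarrow> nat \<Rightarrow> complex; c i j is the coefficient of z^i w^j.\<close>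

definition has_bidegree :: "(nat \<Rightarrow> nat \<Rightarrow> complex) \<Rightarrow> nat \<Rightarrow> nat \<Rightarrow> bool" where
  "has_bidegree c n m \<longleftrightarrow>
     (\<forall>i j. (n < i \<or> m < j) \<longrightarrow> c i j = 0) \<and>
     (\<exists>j. c n j \<noteq> 0) \<and> (\<exists>i. c i m \<noteq> 0)"

definition bipoly :: "(nat \<Rightarrow> nat \<Rightarrow> complex) \<Rightarrow> nat \<Rightarrow> nat \<Rightarrow> complex \<Rightarrow> complex \<Rightarrow> complex" where
  "bipoly c n m z w = (\<Sum>i\<le>n. \<Sum>j\<le>m. c i j * z ^ i * w ^ j)"

text \<open>Reflection: tilde p(z,w) = z^n w^m conj(p(1/conj z, 1/conj w)), as a polynomial.\<close>
definition bipoly_refl :: "(nat \<Rightarrow> nat \<Rightarrow> complex) \<Rightarrow> nat \<Rightarrow> nat \<Rightarrow> complex \<Rightarrow> complex \<Rightarrow> complex" where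
  "bipoly_refl c n m z w = (\<Sum>i\<le>n. \<Sum>j\<le>m. cnj (c i j) * z ^ (n - i) * w ^ (m - j))"

definition stable2 :: "(complex \<Rightarrow> complex \<Rightarrow> complex) \<Rightarrow> bool" where
  "stable2 p \<longleftrightarrow> (\<forall>z w. cmod z \<le> 1 \<longrightarrow> cmod w \<le> 1 \<longrightarrow> p z w \<noteq> 0)"

definition ip_p :: "(complex \<Rightarrow> complex \<Rightarrow> complex) \<Rightarrow> (complex \<Rightarrow> complex \<Rightarrow> complex)
    \<Rightarrow> (complex \<Rightarrow> complex \<Rightarrow> complex) \<Rightarrow> complex" where
  "ip_p p f g = integral (cbox (0::real, 0::real) (2 * pi, 2 * pi))
      (\<lambda>(s, t). f (cis s) (cis t) * cnj (g (cis s) (cis t))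
                 / complex_of_real ((cmod (p (cis s) (cis t)))\<^sup>2))
      / complex_of_real (4 * pi\<^sup>2)"

definition mono_span :: "(nat \<times> nat) set \<Rightarrow> (complex \<Rightarrow> complex \<Rightarrow> complex) set" where
  "mono_span A = {f. \<exists>a::nat \<Rightarrow> nat \<Rightarrow> complex.
      f = (\<lambda>z w. \<Sum>(i, j)\<in>A. a i j * z ^ i * w ^ j)}"

definition orth_compl :: "((complex \<Rightarrow> complex \<Rightarrow> complex) \<Rightarrow> (complex \<Rightarrow> complex \<Rightarrow> complex) \<Rightarrow> complex)
    \<Rightarrow> (complex \<Rightarrow> complex \<Rightarrow> complex) set \<Rightarrow> (complex \<Rightarrow> complex \<Rightarrow> complex) set
    \<Rightarrow> (complex \<Rightarrow> complex \<Rightarrow> complex) set" where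
  "orth_compl ip V W = {f \<in> V. \<forall>g \<in> W. ip f g = 0}"

definition is_onb :: "((complex \<Rightarrow> complex \<Rightarrow> complex) \<Rightarrow> (complex \<Rightarrow> complex \<Rightarrow> complex) \<Rightarrow> complex)
    \<Rightarrow> (complex \<Rightarrow> complex \<Rightarrow> complex) set \<Rightarrow> (complex \<Rightarrow> complex \<Rightarrow> complex) list \<Rightarrow> bool" where
  "is_onb ip V es \<longleftrightarrow>
     (\<forall>k < length es. es ! k \<in> V) \<and>
     (\<forall>k < length es. \<forall>l < length es. ip (es ! k) (es ! l) = (if k = l then 1 else 0)) \<and>
     (\<forall>f \<in> V. \<exists>a :: nat \<Rightarrow> complex. f = (\<lambda>z w. \<Sum>k < length es. a k * (es ! k) z w))"

definition repr_kernel :: "(complex \<Rightarrow> complex \<Rightarrow> complex) list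
    \<Rightarrow> complex \<Rightarrow> complex \<Rightarrow> complex \<Rightarrow> complex \<Rightarrow> complex" where
  "repr_kernel es z w z1 w1 = (\<Sum>k < length es. (es ! k) z w * cnj ((es ! k) z1 w1))"

end

(*
  Write V for the orthogonal complement of w P(n-1,m-1) in P(n,m), where P(a,b) is spanned by the
  monomials of bidegree at most (a,b). Then V has the two orthogonal decompositions
    V = span p~ + H1 + H2 = span p + w H1 + z H2,
  and comparing the resulting expressions for the reproducing kernel of V gives the identity.

  The orthogonality of p and p~ to the other summands is Cauchy's theorem. The orthogonality of H1
  and H2, and of w H1 and z H2, rests on the fact that a g in P(n-1,m) orthogonal to w P(n-1,m-1) is
  orthogonal to z^i w^j for all i < n and j >= 1. By the Gohberg-Semencul formula the Gram matrix of
  the z^i w^j with i < n has a banded inverse, so the projection of g to the span of z^i w^j with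
  1 <= j <= N has coefficients supported near j = N apart from those with j <= m; its norm is then
  controlled by the inner products of g with z^i w^j for j near N, which tend to 0.
  Orthogonality of z g to w^l follows because these inner products are a bounded solution of a linear
  recurrence whose characteristic roots lie outside the closed disc; reflection transfers the
  result to H1.
*)
theory Submission
  imports Defs "HOL-Complex_Analysis.Complex_Analysis"
    "HOL-Computational_Algebra.Fundamental_Theorem_Algebra"
begin

section \<open>Means over the torus\<close>

text \<open>Orthogonality of H1 and H2 is not a formal consequence of their definitions: these
  control only finitely many inner products, whereas the product of z g with w^l pairs g with an
  exponent -1 of z, outside the controlled range. The one available link is that z g is orthogonal
  to w^l p. It couples w^l, ..., w^(l+m) at z-degree 0, and on a finite window of l such a
  recurrence determines nothing. On the whole half-line boundedness does, which is why orthogonality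
  to all j >= 1 must come first. The Gohberg-Semencul formula is applied in z for fixed w: the n by
  n Toeplitz matrix of z-moments of 1/|p|^2 has an inverse whose entries are trigonometric
  polynomials of degree at most m in w. This is the source of the band width m. No dimension is
  counted for the two decompositions: what is left after the projections lies in w P(n-1,m-1) and is
  orthogonal to it.\<close>

definition torus_continuous :: "(complex \<Rightarrow> complex \<Rightarrow> complex) \<Rightarrow> bool" where
  "torus_continuous f \<longleftrightarrow> continuous_on (sphere 0 1 \<times> sphere 0 1) (\<lambda>x. f (fst x) (snd x))"

definition torus_mean :: "(complex \<Rightarrow> complex \<Rightarrow> complex) \<Rightarrow> complex" where
  "torus_mean f = integral (cbox (0::real, 0::real) (2 * pi, 2 * pi))
     (\<lambda>(s, t). f (cis s) (cis t)) / complex_of_real (4 * pi\<^sup>2)"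

lemma torus_continuous_const: "torus_continuous (\<lambda>z w. a)"
  and torus_continuous_fst: "torus_continuous (\<lambda>z w. z)"
  and torus_continuous_snd: "torus_continuous (\<lambda>z w. w)"
  by (auto simp: torus_continuous_def intro!: continuous_intros)

lemma torus_continuous_add:
  "torus_continuous f \<Longrightarrow> torus_continuous g \<Longrightarrow> torus_continuous (\<lambda>z w. f z w + g z w)"
  and torus_continuous_diff:
  "torus_continuous f \<Longrightarrow> torus_continuous g \<Longrightarrow> torus_continuous (\<lambda>z w. f z w - g z w)"
  and torus_continuous_mult:
  "torus_continuous f \<Longrightarrow> torus_continuous g \<Longrightarrow> torus_continuous (\<lambda>z w. f z w * g z w)"
  and torus_continuous_cnj:
  "torus_continuous f \<Longrightarrow> torus_continuous (\<lambda>z w. cnj (f z w))"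
  and torus_continuous_power:
  "torus_continuous f \<Longrightarrow> torus_continuous (\<lambda>z w. f z w ^ k)"
  by (auto simp: torus_continuous_def intro!: continuous_intros)

lemma torus_continuous_sum:
  "(\<And>x. x \<in> A \<Longrightarrow> torus_continuous (f x)) \<Longrightarrow> torus_continuous (\<lambda>z w. \<Sum>x\<in>A. f x z w)"
  by (auto simp: torus_continuous_def intro!: continuous_intros)

text \<open>Nonvanishing is asked on the torus alone; this admits quotients by \<open>p\<close> and
  negative powers of the variables.\<close>

lemma torus_continuous_divide:
  "torus_continuous f \<Longrightarrow> torus_continuous g \<Longrightarrow>
    (\<And>z w. cmod z = 1 \<Longrightarrow> cmod w = 1 \<Longrightarrow> g z w \<noteq> 0) \<Longrightarrow> torus_continuous (\<lambda>z w. f z w / g z w)"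
  by (auto simp: torus_continuous_def intro!: continuous_intros)

lemma torus_continuous_powi:
  "torus_continuous f \<Longrightarrow> (\<And>z w. cmod z = 1 \<Longrightarrow> cmod w = 1 \<Longrightarrow> f z w \<noteq> 0) \<Longrightarrow>
    torus_continuous (\<lambda>z w. f z w powi k)"
  by (auto simp: torus_continuous_def intro!: continuous_intros)

lemma torus_continuous_cmod_sq:
  "torus_continuous f \<Longrightarrow> torus_continuous (\<lambda>z w. complex_of_real ((cmod (f z w))\<^sup>2))"
  by (auto simp: torus_continuous_def intro!: continuous_intros)

lemmas torus_continuous_intros = torus_continuous_const torus_continuous_fst torus_continuous_snd
  torus_continuous_add torus_continuous_diff torus_continuous_mult torus_continuous_cnj
  torus_continuous_power torus_continuous_sum torus_continuous_cmod_sq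

lemma continuous_on_cis_pair:
  assumes "torus_continuous f"
  shows "continuous_on S (\<lambda>(s, t). f (cis s) (cis t))"
proof -
  have "continuous_on S ((\<lambda>x. f (fst x) (snd x)) \<circ> (\<lambda>x. (cis (fst x), cis (snd x))))"
    by (intro continuous_on_compose continuous_intros
          continuous_on_subset[OF assms[unfolded torus_continuous_def]]) auto
  then show ?thesis
    by (simp add: o_def case_prod_unfold)
qed

lemma torus_integrable:
  assumes "torus_continuous f"
  shows "(\<lambda>(s, t). f (cis s) (cis t)) integrable_on cbox (0::real, 0::real) (2 * pi, 2 * pi)"
  by (intro integrable_continuous continuous_on_cis_pair assms)

lemma torus_mean_add:
  assumes "torus_continuous f" "torus_continuous g"
  shows "torus_mean (\<lambda>z w. f z w + g z w) = torus_mean f + torus_mean g"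
  using integral_add[OF torus_integrable[OF assms(1)] torus_integrable[OF assms(2)]]
  by (simp add: torus_mean_def case_prod_unfold add_divide_distrib)

lemma torus_mean_scale: "torus_mean (\<lambda>z w. a * f z w) = a * torus_mean f"
  by (simp add: torus_mean_def case_prod_unfold)

lemma torus_mean_cnj: "torus_mean (\<lambda>z w. cnj (f z w)) = cnj (torus_mean f)"
  by (simp add: torus_mean_def case_prod_unfold integral_cnj)

lemma torus_mean_cong:
  assumes "\<And>z w. cmod z = 1 \<Longrightarrow> cmod w = 1 \<Longrightarrow> f z w = g z w"
  shows "torus_mean f = torus_mean g"
  using assms by (simp add: torus_mean_def)

lemma torus_mean_nonneg:
  assumes "torus_continuous f" 
    and "\<And>z w. cmod z = 1 \<Longrightarrow> cmod w = 1 \<Longrightarrow> f z w = complex_of_real (r z w) \<and> 0 \<le> r z w"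
  shows "torus_mean f \<in> \<real>" "0 \<le> Re (torus_mean f)"
proof -
  let ?B = "cbox (0::real, 0::real) (2 * pi, 2 * pi)"
  have eq: "(\<lambda>(s, t). f (cis s) (cis t)) = (\<lambda>x. complex_of_real (r (cis (fst x)) (cis (snd x))))"
    using assms(2) by (auto simp: fun_eq_iff)
  have int: "(\<lambda>x. complex_of_real (r (cis (fst x)) (cis (snd x)))) integrable_on ?B"
    using torus_integrable[OF assms(1)] by (simp add: eq)
  have "(\<lambda>x. Re (complex_of_real (r (cis (fst x)) (cis (snd x))))) integrable_on ?B"
    using integrable_linear[OF int bounded_linear_Re] by (simp only: o_def)
  then have intr: "(\<lambda>x. r (cis (fst x)) (cis (snd x))) integrable_on ?B" by simp
  have "integral ?B (\<lambda>(s, t). f (cis s) (cis t)) =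
      complex_of_real (integral ?B (\<lambda>x. r (cis (fst x)) (cis (snd x))))"
    unfolding eq by (intro integral_unique has_integral_of_real integrable_integral intr)
  moreover have "0 \<le> integral ?B (\<lambda>x. r (cis (fst x)) (cis (snd x)))"
    using assms(2) by (intro integral_nonneg intr) auto
  ultimately show "torus_mean f \<in> \<real>" "0 \<le> Re (torus_mean f)"
    by (simp_all add: torus_mean_def)
qed

lemma torus_mean_iterated:
  assumes "torus_continuous f"
  shows "torus_mean f = integral {0..2 * pi} (\<lambda>s. integral {0..2 * pi} (\<lambda>t. f (cis s) (cis t)))
      / complex_of_real (4 * pi\<^sup>2)"
  using integral_prod_continuous[OF continuous_on_cis_pair[OF assms]]
  by (simp add: torus_mean_def)

lemma torus_continuous_swap:
  assumes "torus_continuous f"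
  shows "torus_continuous (\<lambda>z w. f w z)"
proof -
  have "continuous_on (sphere 0 1 \<times> sphere 0 1) ((\<lambda>x. f (fst x) (snd x)) \<circ> prod.swap)"
    by (intro continuous_on_compose continuous_on_swap
          continuous_on_subset[OF assms[unfolded torus_continuous_def]]) auto
  then show ?thesis by (simp add: torus_continuous_def o_def)
qed

lemma torus_mean_swap:
  assumes "torus_continuous f"
  shows "torus_mean (\<lambda>z w. f w z) = torus_mean f"
  using integral_swap_continuous[OF continuous_on_cis_pair[OF assms]]
  by (simp add: torus_mean_iterated assms torus_continuous_swap)

text \<open>Cauchy's theorem on the unit circle: the factor \<open>cis t\<close> is what dz = i
  e^(it) dt leaves behind.\<close>

lemma circle_mean_zero:
  assumes "f holomorphic_on cball 0 1"
  shows "integral {0..2 * pi} (\<lambda>t. cis t * f (cis t)) = 0"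
proof -
  have period: "exp (\<i> * (2 * complex_of_real pi)) = 1"
    using exp_two_pi_i' by (simp add: mult.commute)
  have "(f has_contour_integral 0) (part_circlepath 0 1 0 (2 * pi))"
    by (rule Cauchy_theorem_convex_simple[OF assms])
       (use path_image_part_circlepath_subset'[of 1 0 0 "2 * pi"] in
         \<open>auto simp: period\<close>)
  then have "contour_integral (part_circlepath 0 1 0 (2 * pi)) f = 0"
    by (rule contour_integral_unique)
  then have "0 = integral {0..2 * pi} (\<lambda>t. \<i> * (cis t * f (cis t)))"
    by (simp add: contour_integral_part_circlepath_eq mult_ac)
  then show ?thesis by simp
qed

text \<open>By Fubini each slice with z on the circle is treated alone, so holomorphy in one
  variable suffices and \<open>h\<close> may depend on z in any way.\<close>

lemma torus_mean_holomorphic_snd: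
  assumes "torus_continuous f"
    and "\<And>z. cmod z = 1 \<Longrightarrow> \<exists>h. h holomorphic_on cball 0 1 \<and> (\<forall>w. cmod w = 1 \<longrightarrow> f z w = w * h w)"
  shows "torus_mean f = 0"
proof -
  have "integral {0..2 * pi} (\<lambda>t. f (cis s) (cis t)) = 0" for s
  proof -
    obtain h where "h holomorphic_on cball 0 1" "\<forall>w. cmod w = 1 \<longrightarrow> f (cis s) w = w * h w"
      using assms(2)[of "cis s"] by auto
    then show ?thesis using circle_mean_zero[of h] by simp
  qed
  then show ?thesis by (simp add: torus_mean_iterated[OF assms(1)])
qed

lemma torus_mean_holomorphic_fst:
  assumes "torus_continuous f"
    and "\<And>w. cmod w = 1 \<Longrightarrow> \<exists>h. h holomorphic_on cball 0 1 \<and> (\<forall>z. cmod z = 1 \<longrightarrow> f z w = z * h z)"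
  shows "torus_mean f = 0"
  using torus_mean_holomorphic_snd[OF torus_continuous_swap[OF assms(1)]] assms
  by (simp add: torus_mean_swap[OF assms(1)])

lemma torus_mean_1: "torus_mean (\<lambda>z w. 1) = 1"
  by (simp add: torus_mean_iterated torus_continuous_const power2_eq_square scaleR_conv_of_real)

section \<open>Weighted inner products\<close>

locale torus_weight =
  fixes p :: "complex \<Rightarrow> complex \<Rightarrow> complex"
  assumes weight_continuous: "torus_continuous p"
    and weight_nonzero: "\<And>z w. cmod z = 1 \<Longrightarrow> cmod w = 1 \<Longrightarrow> p z w \<noteq> 0"
begin

abbreviation ip :: "(complex \<Rightarrow> complex \<Rightarrow> complex) \<Rightarrow> (complex \<Rightarrow> complex \<Rightarrow> complex) \<Rightarrow> complex" where
  "ip \<equiv> ip_p p"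

lemma ip_eq_mean: "ip f g = torus_mean (\<lambda>z w. f z w * cnj (g z w) / complex_of_real ((cmod (p z w))\<^sup>2))"
  by (simp add: ip_p_def torus_mean_def)

lemma weighted_continuous:
  assumes "torus_continuous f" "torus_continuous g"
  shows "torus_continuous (\<lambda>z w. f z w * cnj (g z w) / complex_of_real ((cmod (p z w))\<^sup>2))"
  using weight_nonzero
  by (intro torus_continuous_divide torus_continuous_intros assms weight_continuous) auto

lemma ip_cong:
  assumes "\<And>z w. cmod z = 1 \<Longrightarrow> cmod w = 1 \<Longrightarrow> f z w = f' z w"
    and "\<And>z w. cmod z = 1 \<Longrightarrow> cmod w = 1 \<Longrightarrow> g z w = g' z w"
  shows "ip f g = ip f' g'"
  unfolding ip_eq_mean by (rule torus_mean_cong) (simp add: assms)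

lemma ip_cnj: "cnj (ip f g) = ip g f"
  unfolding ip_eq_mean by (simp flip: torus_mean_cnj add: mult.commute)

lemma ip_scale_left: "ip (\<lambda>z w. a * f z w) g = a * ip f g"
  unfolding ip_eq_mean by (simp flip: torus_mean_scale add: mult.assoc)

lemma ip_scale_right: "ip f (\<lambda>z w. a * g z w) = cnj a * ip f g"
  by (metis ip_cnj ip_scale_left complex_cnj_mult)

lemma ip_zero_left [simp]: "ip (\<lambda>z w. 0) g = 0"
  using ip_scale_left[of 0 "\<lambda>z w. 0" g] by simp

lemma ip_zero_right [simp]: "ip f (\<lambda>z w. 0) = 0"
  using ip_cnj[of "\<lambda>z w. 0" f] by simp

lemma ip_add_left:
  assumes "torus_continuous f" "torus_continuous h" "torus_continuous g"
  shows "ip (\<lambda>z w. f z w + h z w) g = ip f g + ip h g"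
  using torus_mean_add[OF weighted_continuous[OF assms(1,3)] weighted_continuous[OF assms(2,3)]]
  unfolding ip_eq_mean by (simp add: distrib_right add_divide_distrib)

lemma ip_add_right:
  assumes "torus_continuous f" "torus_continuous h" "torus_continuous g"
  shows "ip g (\<lambda>z w. f z w + h z w) = ip g f + ip g h"
  by (metis ip_add_left[OF assms] ip_cnj complex_cnj_add)

lemma ip_diff_left:
  assumes "torus_continuous f" "torus_continuous h" "torus_continuous g"
  shows "ip (\<lambda>z w. f z w - h z w) g = ip f g - ip h g"
  using ip_add_left[of f "\<lambda>z w. - 1 * h z w" g] ip_scale_left[of "-1" h g] assms
    torus_continuous_mult[of "\<lambda>z w. - 1" h]
  by (simp add: torus_continuous_const)

lemma ip_diff_right:
  assumes "torus_continuous f" "torus_continuous h" "torus_continuous g"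
  shows "ip g (\<lambda>z w. f z w - h z w) = ip g f - ip g h"
  by (metis ip_diff_left[OF assms] ip_cnj complex_cnj_diff)

lemma ip_sum_left:
  assumes "\<And>x. x \<in> A \<Longrightarrow> torus_continuous (f x)" "torus_continuous g"
  shows "ip (\<lambda>z w. \<Sum>x\<in>A. a x * f x z w) g = (\<Sum>x\<in>A. a x * ip (f x) g)"
  using assms(1)
proof (induction A rule: infinite_finite_induct)
  case (insert x A)
  then have "ip (\<lambda>z w. a x * f x z w + (\<Sum>x\<in>A. a x * f x z w)) g
      = a x * ip (f x) g + (\<Sum>x\<in>A. a x * ip (f x) g)"
    using assms(2)
    by (subst ip_add_left) (auto simp: ip_scale_left intro!: torus_continuous_intros)
  with insert.hyps show ?case by simp
qed auto

lemma ip_sum_right: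
  assumes "\<And>x. x \<in> A \<Longrightarrow> torus_continuous (f x)" "torus_continuous g"
  shows "ip g (\<lambda>z w. \<Sum>x\<in>A. a x * f x z w) = (\<Sum>x\<in>A. cnj (a x) * ip g (f x))"
  using arg_cong[where f = cnj, OF ip_sum_left[where a = a, OF assms]] by (simp add: ip_cnj)

text \<open>Multiplication by a function of modulus one is unitary. With u = z, u = w or a monomial
  this yields the shifts and reflections used later.\<close>

lemma ip_unimodular:
  assumes "\<And>z w. cmod z = 1 \<Longrightarrow> cmod w = 1 \<Longrightarrow> cmod (u z w) = 1"
  shows "ip (\<lambda>z w. u z w * f z w) (\<lambda>z w. u z w * g z w) = ip f g"
  unfolding ip_eq_mean
proof (rule torus_mean_cong, goal_cases)
  case (1 z w)
  have "u z w * cnj (u z w) = 1"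
    using assms[OF 1] by (simp add: complex_norm_square[symmetric])
  then have "u z w * f z w * cnj (u z w * g z w) = f z w * cnj (g z w)"
    by (simp add: mult_ac)
  then show ?case by (simp only:)
qed

lemma ip_self:
  assumes "torus_continuous f"
  shows "ip f f \<in> \<real>" "0 \<le> Re (ip f f)"
proof -
  have *: "f z w * cnj (f z w) / complex_of_real ((cmod (p z w))\<^sup>2)
      = complex_of_real ((cmod (f z w))\<^sup>2 / (cmod (p z w))\<^sup>2)
    \<and> 0 \<le> (cmod (f z w))\<^sup>2 / (cmod (p z w))\<^sup>2" for z w
    by (simp add: complex_norm_square[symmetric])
  show "ip f f \<in> \<real>" "0 \<le> Re (ip f f)"
    unfolding ip_eq_mean using torus_mean_nonneg[OF weighted_continuous[OF assms assms] *] by auto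
qed

lemma ip_diff_scale_self:
  assumes f: "torus_continuous f" and g: "torus_continuous g"
  shows "ip (\<lambda>z w. f z w - a * g z w) (\<lambda>z w. f z w - a * g z w)
    = ip f f - cnj a * ip f g - a * ip g f + a * cnj a * ip g g"
proof -
  have ag: "torus_continuous (\<lambda>z w. a * g z w)" by (intro torus_continuous_intros g)
  have "ip (\<lambda>z w. f z w - a * g z w) (\<lambda>z w. f z w - a * g z w)
      = (ip f f - cnj a * ip f g) - a * (ip g f - cnj a * ip g g)"
    using f g ag by (simp add: ip_diff_left ip_diff_right torus_continuous_diff ip_scale_left ip_scale_right)
  then show ?thesis by (simp add: algebra_simps)
qed

lemma Cauchy_Schwarz_sq:
  assumes f: "torus_continuous f" and g: "torus_continuous g"
  shows "(cmod (ip f g))\<^sup>2 \<le> Re (ip f f) * Re (ip g g)"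
proof -
  define F G q where "F = Re (ip f f)" and "G = Re (ip g g)" and "q = (cmod (ip f g))\<^sup>2"
  have FG: "ip f f = of_real F" "ip g g = of_real G" "0 \<le> F" "0 \<le> G"
    using ip_self[OF f] ip_self[OF g] by (auto simp: F_def G_def)
  have pq: "ip f g * ip g f = of_real q"
    using complex_norm_square[of "ip f g"] by (simp add: q_def ip_cnj)
  \<comment> \<open>Squared norm of f - x (ip f g) g. The coefficient carries the phase of
    \<open>ip f g\<close>, so a quadratic in the real variable x results.\<close>
  have key: "0 \<le> F - 2 * x * q + x\<^sup>2 * q * G" for x
  proof -
    let ?a = "of_real x * ip f g"
    have "ip (\<lambda>z w. f z w - ?a * g z w) (\<lambda>z w. f z w - ?a * g z w)
        = of_real F - 2 * of_real x * (ip f g * ip g f) + (of_real x)\<^sup>2 * (ip f g * ip g f) * of_real G"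
      unfolding ip_diff_scale_self[OF f g] by (simp add: ip_cnj FG algebra_simps power2_eq_square)
    also have "\<dots> = of_real (F - 2 * x * q + x\<^sup>2 * q * G)"
      by (simp add: pq)
    finally have "ip (\<lambda>z w. f z w - ?a * g z w) (\<lambda>z w. f z w - ?a * g z w) = \<dots>" .
    moreover have "torus_continuous (\<lambda>z w. f z w - ?a * g z w)"
      by (intro torus_continuous_intros f g)
    ultimately show ?thesis using ip_self(2) by fastforce
  qed
  have "q \<le> F * G"
  \<comment> \<open>For G = 0 the expression is affine in x and equals -F - 2 at x = (F + 1) / q,
    which rules out q > 0. Otherwise x = 1 / G is the minimizer.\<close>
  proof (cases "G = 0")
    case True
    then show ?thesis
      using key[of "(F + 1) / q"] FG(3) by (cases "q = 0") simp_all
  next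
    case False
    then show ?thesis
      using key[of "1 / G"] FG(4) by (auto simp: field_simps power2_eq_square)
  qed
  then show ?thesis by (simp add: F_def G_def q_def)
qed

definition nrm :: "(complex \<Rightarrow> complex \<Rightarrow> complex) \<Rightarrow> real" where
  "nrm f = sqrt (Re (ip f f))"

lemma nrm_nonneg: "torus_continuous f \<Longrightarrow> 0 \<le> nrm f"
  by (simp add: nrm_def ip_self)

lemma Cauchy_Schwarz:
  assumes f: "torus_continuous f" and g: "torus_continuous g"
  shows "cmod (ip f g) \<le> nrm f * nrm g"
  using real_sqrt_le_mono[OF Cauchy_Schwarz_sq[OF assms]] by (simp add: nrm_def real_sqrt_mult)

text \<open>Cauchy-Schwarz makes null vectors orthogonal to everything. Projections can thus be
  built on semidefiniteness, and definiteness on polynomials is deduced from it.\<close>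

lemma ip_null:
  assumes "torus_continuous f" "torus_continuous g" "ip f f = 0"
  shows "ip f g = 0" "ip g f = 0"
  using Cauchy_Schwarz_sq[OF assms(1,2)] Cauchy_Schwarz_sq[OF assms(2,1)] assms(3) by auto

end

section \<open>Spans of monomials\<close>

abbreviation mono2 :: "nat \<Rightarrow> nat \<Rightarrow> complex \<Rightarrow> complex \<Rightarrow> complex" where
  "mono2 i j \<equiv> (\<lambda>z w. z ^ i * w ^ j)"

lemma mono_span_iff:
  "f \<in> mono_span A \<longleftrightarrow> (\<exists>a. f = (\<lambda>z w. \<Sum>x\<in>A. a x * mono2 (fst x) (snd x) z w))"
proof
  assume "f \<in> mono_span A"
  then obtain a where "f = (\<lambda>z w. \<Sum>(i, j)\<in>A. a i j * z ^ i * w ^ j)"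
    by (auto simp: mono_span_def)
  then have "f = (\<lambda>z w. \<Sum>x\<in>A. a (fst x) (snd x) * mono2 (fst x) (snd x) z w)"
    by (simp add: case_prod_unfold mult.assoc)
  then show "\<exists>a. f = (\<lambda>z w. \<Sum>x\<in>A. a x * mono2 (fst x) (snd x) z w)"
    by (intro exI[of _ "\<lambda>x. a (fst x) (snd x)"])
next
  assume "\<exists>a. f = (\<lambda>z w. \<Sum>x\<in>A. a x * mono2 (fst x) (snd x) z w)"
  then obtain a where "f = (\<lambda>z w. \<Sum>x\<in>A. a x * mono2 (fst x) (snd x) z w)" by blast
  then have "f = (\<lambda>z w. \<Sum>(i, j)\<in>A. a (i, j) * z ^ i * w ^ j)"
    by (simp add: case_prod_unfold mult.assoc)
  then show "f \<in> mono_span A"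
    unfolding mono_span_def by (intro CollectI exI[of _ "\<lambda>i j. a (i, j)"])
qed

lemma mono_span_zero: "(\<lambda>z w. 0) \<in> mono_span A"
  unfolding mono_span_iff by (intro exI[of _ "\<lambda>x. 0"]) simp

lemma mono_span_add:
  assumes "f \<in> mono_span A" "g \<in> mono_span A"
  shows "(\<lambda>z w. f z w + g z w) \<in> mono_span A"
proof -
  obtain a b where "f = (\<lambda>z w. \<Sum>x\<in>A. a x * mono2 (fst x) (snd x) z w)"
    "g = (\<lambda>z w. \<Sum>x\<in>A. b x * mono2 (fst x) (snd x) z w)"
    using assms unfolding mono_span_iff by blast
  then have "(\<lambda>z w. f z w + g z w) = (\<lambda>z w. \<Sum>x\<in>A. (a x + b x) * mono2 (fst x) (snd x) z w)"
    by (simp add: distrib_right sum.distrib)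
  then show ?thesis unfolding mono_span_iff by (intro exI[of _ "\<lambda>x. a x + b x"])
qed

lemma mono_span_scale:
  assumes "f \<in> mono_span A"
  shows "(\<lambda>z w. c * f z w) \<in> mono_span A"
proof -
  obtain a where "f = (\<lambda>z w. \<Sum>x\<in>A. a x * mono2 (fst x) (snd x) z w)"
    using assms unfolding mono_span_iff by blast
  then have "(\<lambda>z w. c * f z w) = (\<lambda>z w. \<Sum>x\<in>A. (c * a x) * mono2 (fst x) (snd x) z w)"
    by (simp add: sum_distrib_left mult.assoc)
  then show ?thesis unfolding mono_span_iff by (intro exI[of _ "\<lambda>x. c * a x"])
qed

lemma mono_span_diff:
  assumes "f \<in> mono_span A" "g \<in> mono_span A"
  shows "(\<lambda>z w. f z w - g z w) \<in> mono_span A"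
  using mono_span_add[OF assms(1) mono_span_scale[OF assms(2), of "-1"]] by simp

lemma mono_span_sum:
  assumes "\<And>x. x \<in> X \<Longrightarrow> f x \<in> mono_span A"
  shows "(\<lambda>z w. \<Sum>x\<in>X. f x z w) \<in> mono_span A"
  using assms
  by (induction X rule: infinite_finite_induct) (auto intro: mono_span_zero mono_span_add)

lemma mono_span_mono2:
  assumes "finite A" "(i, j) \<in> A"
  shows "mono2 i j \<in> mono_span A"
proof -
  have "(\<Sum>x\<in>A. (if x = (i, j) then 1 else 0) * mono2 (fst x) (snd x) z w)
      = (\<Sum>x\<in>A. if x = (i, j) then mono2 i j z w else 0)" for z w
    by (rule sum.cong) auto
  then have "mono2 i j = (\<lambda>z w. \<Sum>x\<in>A. (if x = (i, j) then 1 else 0) * mono2 (fst x) (snd x) z w)"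
    using assms by simp
  then show ?thesis unfolding mono_span_iff by (intro exI[of _ "\<lambda>x. if x = (i, j) then 1 else 0"])
qed

lemma mono_span_induct [consumes 1, case_names zero add scale mono]:
  assumes "f \<in> mono_span A" "P (\<lambda>z w. 0)"
    and add: "\<And>f g. f \<in> mono_span A \<Longrightarrow> g \<in> mono_span A \<Longrightarrow> P f \<Longrightarrow> P g \<Longrightarrow> P (\<lambda>z w. f z w + g z w)"
    and scale: "\<And>c f. f \<in> mono_span A \<Longrightarrow> P f \<Longrightarrow> P (\<lambda>z w. c * f z w)"
    and mono: "\<And>i j. (i, j) \<in> A \<Longrightarrow> P (mono2 i j)"
  shows "P f"
proof -
  obtain a where f: "f = (\<lambda>z w. \<Sum>x\<in>A. a x * mono2 (fst x) (snd x) z w)"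
    using assms(1) unfolding mono_span_iff by blast
  have "finite B \<Longrightarrow> B \<subseteq> A \<Longrightarrow> finite A \<Longrightarrow> P (\<lambda>z w. \<Sum>x\<in>B. a x * mono2 (fst x) (snd x) z w)" for B
  proof (induction B rule: finite_induct)
    case (insert x B)
    then have B: "(\<lambda>z w. \<Sum>x\<in>B. a x * mono2 (fst x) (snd x) z w) \<in> mono_span A"
      by (intro mono_span_sum mono_span_scale mono_span_mono2) auto
    have x: "mono2 (fst x) (snd x) \<in> mono_span A" "P (mono2 (fst x) (snd x))"
      using insert.prems by (auto intro!: mono_span_mono2 mono)
    from add[OF mono_span_scale[OF x(1)] B scale[OF x]] insert show ?case by simp
  qed (simp add: assms(2))
  \<comment> \<open>For infinite \<open>A\<close> the sum is 0 by convention, so f is the zero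
    function and the zero case applies.\<close>
  then show ?thesis
    using assms(2) by (cases "finite A") (simp_all add: f)
qed

lemma mono_span_subset: "f \<in> mono_span A \<Longrightarrow> finite B \<Longrightarrow> A \<subseteq> B \<Longrightarrow> f \<in> mono_span B"
  by (induction f rule: mono_span_induct)
     (auto intro: mono_span_zero mono_span_add mono_span_scale mono_span_mono2)

lemma mono_span_mult:
  assumes "f \<in> mono_span A" "g \<in> mono_span B" "finite C"
    and "\<And>i j k l. (i, j) \<in> A \<Longrightarrow> (k, l) \<in> B \<Longrightarrow> (i + k, j + l) \<in> C"
  shows "(\<lambda>z w. f z w * g z w) \<in> mono_span C"
  using assms(1,4)
proof (induction f rule: mono_span_induct)
  case (mono i j)
  show ?case using assms(2)
  proof (induction g rule: mono_span_induct)
    case (mono k l)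
    have "mono2 (i + k) (j + l) \<in> mono_span C"
      using assms(3,4) \<open>(i, j) \<in> A\<close> \<open>(k, l) \<in> B\<close> by (intro mono_span_mono2)
    then show ?case by (simp add: power_add mult_ac)
  next
    case (scale c f)
    then show ?case using mono_span_scale by (fastforce simp: mult_ac)
  qed (auto simp: distrib_left intro: mono_span_zero mono_span_add)
next
  case (scale c f)
  then show ?case using mono_span_scale by (fastforce simp: mult_ac)
qed (auto simp: distrib_right intro: mono_span_zero mono_span_add)

lemma mono_span_shift:
  assumes "f \<in> mono_span A" "finite C" "\<And>i j. (i, j) \<in> A \<Longrightarrow> (i + k, j + l) \<in> C"
  shows "(\<lambda>z w. z ^ k * w ^ l * f z w) \<in> mono_span C"
  using assms by (intro mono_span_mult[where A = "{(k, l)}" and B = A] mono_span_mono2)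
    (auto simp: add.commute)

lemma mono_span_Un:
  assumes "f \<in> mono_span (A \<union> B)" "finite A" "finite B"
  obtains g h where "g \<in> mono_span A" "h \<in> mono_span B" "f = (\<lambda>z w. g z w + h z w)"
proof -
  have "\<exists>g\<in>mono_span A. \<exists>h\<in>mono_span B. f = (\<lambda>z w. g z w + h z w)"
    using assms(1)
  proof (induction f rule: mono_span_induct)
    case (add f f')
    then obtain g h g' h' where "g \<in> mono_span A" "h \<in> mono_span B" "f = (\<lambda>z w. g z w + h z w)"
      "g' \<in> mono_span A" "h' \<in> mono_span B" "f' = (\<lambda>z w. g' z w + h' z w)" by blast
    then show ?case
      by (intro bexI[of _ "\<lambda>z w. g z w + g' z w"] bexI[of _ "\<lambda>z w. h z w + h' z w"] mono_span_add)
        (auto simp: algebra_simps)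
  next
    case (scale c f)
    then obtain g h where "g \<in> mono_span A" "h \<in> mono_span B" "f = (\<lambda>z w. g z w + h z w)" by blast
    then show ?case
      by (intro bexI[of _ "\<lambda>z w. c * g z w"] bexI[of _ "\<lambda>z w. c * h z w"] mono_span_scale)
        (auto simp: algebra_simps)
  next
    case zero
    then show ?case
      by (intro bexI[of _ "\<lambda>z w. 0"]) (auto intro: mono_span_zero)
  next
    case (mono i j)
    then show ?case
    proof
      assume "(i, j) \<in> A"
      then show ?thesis using assms
        by (intro bexI[of _ "mono2 i j"] bexI[of _ "\<lambda>z w. 0"] mono_span_mono2 mono_span_zero) auto
    next
      assume "(i, j) \<in> B"
      then show ?thesis using assms
        by (intro bexI[of _ "\<lambda>z w. 0"] bexI[of _ "mono2 i j"] mono_span_mono2 mono_span_zero) auto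
    qed
  qed
  then show ?thesis using that by blast
qed

text \<open>Division by a monomial acts on exponents, since a pointwise quotient says nothing where
  z or w vanishes.\<close>

lemma mono_span_unshift:
  assumes "f \<in> mono_span A" "finite B"
    and "\<And>i j. (i, j) \<in> A \<Longrightarrow> k \<le> i \<and> l \<le> j \<and> (i - k, j - l) \<in> B"
  obtains g where "g \<in> mono_span B" "f = (\<lambda>z w. mono2 k l z w * g z w)"
proof -
  have "\<exists>g\<in>mono_span B. f = (\<lambda>z w. mono2 k l z w * g z w)"
    using assms(1)
  proof (induction f rule: mono_span_induct)
    case zero
    then show ?case by (intro bexI[of _ "\<lambda>z w. 0"] mono_span_zero) simp
  next
    case (add f f')
    then obtain g g' where "g \<in> mono_span B" "f = (\<lambda>z w. mono2 k l z w * g z w)"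
      "g' \<in> mono_span B" "f' = (\<lambda>z w. mono2 k l z w * g' z w)" by blast
    then show ?case
      by (intro bexI[of _ "\<lambda>z w. g z w + g' z w"] mono_span_add) (auto simp: distrib_left)
  next
    case (scale a f)
    then obtain g where "g \<in> mono_span B" "f = (\<lambda>z w. mono2 k l z w * g z w)" by blast
    then show ?case
      by (intro bexI[of _ "\<lambda>z w. a * g z w"] mono_span_scale) (auto simp: mult_ac)
  next
    case (mono i j)
    then have *: "k \<le> i" "l \<le> j" "(i - k, j - l) \<in> B" using assms(3) by auto
    have "x ^ i = x ^ k * x ^ (i - k)" "x ^ j = x ^ l * x ^ (j - l)" for x :: complex
      using * by (simp_all flip: power_add)
    then have "mono2 i j = (\<lambda>z w. mono2 k l z w * mono2 (i - k) (j - l) z w)"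
      by (simp add: fun_eq_iff mult_ac)
    then show ?case
      by (intro bexI[of _ "mono2 (i - k) (j - l)"] mono_span_mono2 assms(2) *)
  qed
  then show ?thesis using that by blast
qed

lemma mono_span_remove:
  assumes "f \<in> mono_span A" "finite A" "(i, j) \<in> A"
  obtains a where "(\<lambda>z w. f z w - a * mono2 i j z w) \<in> mono_span (A - {(i, j)})"
proof -
  have "A = (A - {(i, j)}) \<union> {(i, j)}" using assms(3) by auto
  then obtain g h where g: "g \<in> mono_span (A - {(i, j)})" and h: "h \<in> mono_span {(i, j)}"
    and f: "f = (\<lambda>z w. g z w + h z w)"
    using mono_span_Un[of f "A - {(i, j)}" "{(i, j)}"] assms by auto
  obtain a where "h = (\<lambda>z w. a * mono2 i j z w)"
    using h unfolding mono_span_iff by force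
  then show ?thesis using that[of a] g f by simp
qed

lemma orth_compl_iff: "f \<in> orth_compl ip V W \<longleftrightarrow> f \<in> V \<and> (\<forall>g\<in>W. ip f g = 0)"
  by (simp add: orth_compl_def)

lemma torus_continuous_mono2: "torus_continuous (mono2 i j)"
  by (intro torus_continuous_intros)

lemma torus_continuous_mono_span: "f \<in> mono_span A \<Longrightarrow> torus_continuous f"
  by (induction f rule: mono_span_induct) (auto intro!: torus_continuous_intros)

section \<open>Fourier orthogonality of monomials on the torus\<close>

lemma cnj_unimodular: "cmod z = 1 \<Longrightarrow> cnj z = inverse z"
  using complex_norm_square[of z] inverse_unique[of z "cnj z"] by simp

text \<open>One positive exponent suffices for Cauchy's theorem. If none is positive, conjugation on
  the torus reverses both signs.\<close>

lemma torus_mean_powi: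
  "torus_mean (\<lambda>z w. z powi k * w powi l) = (if k = 0 \<and> l = 0 then 1 else 0)"
proof -
  have cont: "torus_continuous (\<lambda>z w. z powi k * w powi l)" for k l
    by (intro torus_continuous_mult torus_continuous_powi torus_continuous_intros) auto
  have pos: "torus_mean (\<lambda>z w. z powi k * w powi l) = 0" if "k > 0 \<or> l > 0" for k l :: int
    using that
  proof
    assume k: "k > 0"
    show ?thesis
    proof (rule torus_mean_holomorphic_fst[OF cont])
      fix w :: complex
      show "\<exists>h. h holomorphic_on cball 0 1 \<and> (\<forall>z. cmod z = 1 \<longrightarrow> z powi k * w powi l = z * h z)"
        using k by (intro exI[of _ "\<lambda>z. z ^ (nat k - 1) * w powi l"])
          (auto intro!: holomorphic_intros simp: power_int_def simp flip: power_Suc mult.assoc)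
    qed
  next
    assume l: "l > 0"
    show ?thesis
    proof (rule torus_mean_holomorphic_snd[OF cont])
      fix z :: complex
      show "\<exists>h. h holomorphic_on cball 0 1 \<and> (\<forall>w. cmod w = 1 \<longrightarrow> z powi k * w powi l = w * h w)"
        using l by (intro exI[of _ "\<lambda>w. w ^ (nat l - 1) * z powi k"])
          (auto intro!: holomorphic_intros simp: power_int_def mult_ac
            simp flip: power_Suc power_Suc2 mult.assoc)
    qed
  qed
  show ?thesis
  proof (cases "k = 0 \<and> l = 0")
    case True
    then show ?thesis using torus_mean_1 by simp
  next
    case False
    have "torus_mean (\<lambda>z w. z powi k * w powi l) = cnj (torus_mean (\<lambda>z w. z powi (- k) * w powi (- l)))"
      unfolding torus_mean_cnj[symmetric] by (rule torus_mean_cong) (simp add: cnj_unimodular power_int_inverse power_int_minus)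
    moreover have "(k > 0 \<or> l > 0) \<or> - k > 0 \<or> - l > 0" using False by linarith
    ultimately show ?thesis using pos False by fastforce
  qed
qed

lemma mono2_cnj_torus:
  assumes "cmod z = 1" "cmod w = 1"
  shows "mono2 k l z w * cnj (mono2 a b z w) = z powi (int k - int a) * w powi (int l - int b)"
proof -
  have "z \<noteq> 0" "w \<noteq> 0" using assms by auto
  then show ?thesis
    using assms by (simp add: cnj_unimodular power_int_diff divide_inverse power_inverse)
qed

lemma torus_mean_mono2:
  "torus_mean (\<lambda>z w. mono2 i j z w * cnj (mono2 k l z w)) = (if i = k \<and> j = l then 1 else 0)"
proof -
  have "torus_mean (\<lambda>z w. mono2 i j z w * cnj (mono2 k l z w))
      = torus_mean (\<lambda>z w. z powi (int i - int k) * w powi (int j - int l))"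
    by (rule torus_mean_cong) (rule mono2_cnj_torus)
  then show ?thesis by (simp add: torus_mean_powi)
qed

section \<open>Orthogonal projections, definiteness and reflection\<close>

context torus_weight
begin

lemma ip_span_zero:
  assumes "f \<in> mono_span A" "torus_continuous g" "\<And>i j. (i, j) \<in> A \<Longrightarrow> ip (mono2 i j) g = 0"
  shows "ip f g = 0"
  using assms(1)
proof (induction f rule: mono_span_induct)
  case (add f f')
  then show ?case
    using ip_add_left[OF torus_continuous_mono_span torus_continuous_mono_span assms(2)] by simp
qed (simp_all add: assms(3) ip_scale_left)

text \<open>Gram-Schmidt, one monomial at a time. The induction is over all f at once, because its
  hypothesis is applied both to f and to the new monomial.\<close>

lemma projection_exists:
  assumes "finite A" "torus_continuous f"
  obtains h where "h \<in> mono_span A" "\<And>u. u \<in> mono_span A \<Longrightarrow> ip (\<lambda>z w. f z w - h z w) u = 0"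
proof -
  have "\<forall>f. torus_continuous f \<longrightarrow> (\<exists>h\<in>mono_span A. \<forall>u\<in>mono_span A. ip (\<lambda>z w. f z w - h z w) u = 0)"
    using assms(1)
  proof (induction A rule: finite_induct)
    case empty
    have "u = (\<lambda>z w. 0)" if "u \<in> mono_span {}" for u
      using that by (simp add: mono_span_def)
    then show ?case using mono_span_zero by fastforce
  next
    case (insert x A)
    obtain i j where x: "x = (i, j)" by fastforce
    obtain e where e: "e \<in> mono_span A" "\<And>u. u \<in> mono_span A \<Longrightarrow> ip (\<lambda>z w. mono2 i j z w - e z w) u = 0"
      using insert.IH[rule_format, OF torus_continuous_mono2] by blast
    define y where "y = (\<lambda>z w. mono2 i j z w - e z w)"
    have tce: "torus_continuous e" by (rule torus_continuous_mono_span[OF e(1)])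
    have yA: "y \<in> mono_span (insert x A)"
      unfolding y_def using insert.hyps e(1) x
      by (intro mono_span_diff mono_span_mono2) (auto intro: mono_span_subset)
    have tcy: "torus_continuous y" by (rule torus_continuous_mono_span[OF yA])
    have split: "ip v u = 0" if v: "torus_continuous v" "\<And>u. u \<in> mono_span A \<Longrightarrow> ip v u = 0" "ip v y = 0"
      and u: "u \<in> mono_span (insert x A)" for v u
    proof -
      have "ip v (mono2 i j) = ip v y + ip v e"
        using ip_add_right[OF tcy tce v(1)] by (simp add: y_def)
      then have "ip v (mono2 i j) = 0" using v e by simp
      moreover have "ip v (mono2 k l) = 0" if "(k, l) \<in> A" for k l
        using v(2) that insert.hyps mono_span_mono2 by blast
      ultimately have "ip (mono2 k l) v = 0" if "(k, l) \<in> insert x A" for k l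
        using that x ip_cnj[of v "mono2 k l"] by auto
      then have "ip u v = 0" using ip_span_zero[OF u v(1)] by blast
      then show ?thesis using ip_cnj[of u v] by simp
    qed
    show ?case
    proof (intro allI impI)
      fix f assume f: "torus_continuous f"
      obtain h where h: "h \<in> mono_span A" "\<And>u. u \<in> mono_span A \<Longrightarrow> ip (\<lambda>z w. f z w - h z w) u = 0"
        using insert.IH[rule_format, OF f] by blast
      have tch: "torus_continuous h" by (rule torus_continuous_mono_span[OF h(1)])
      define a where "a = ip (\<lambda>z w. f z w - h z w) y / ip y y"
      define v where "v = (\<lambda>z w. (f z w - h z w) - a * y z w)"
      have ipv: "ip v u = ip (\<lambda>z w. f z w - h z w) u - a * ip y u" if "torus_continuous u" for u
        unfolding v_def using that f tch tcy
        by (subst ip_diff_left) (auto intro!: torus_continuous_intros simp: ip_scale_left)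
      have "ip v u = 0" if "u \<in> mono_span (insert x A)" for u
      proof (rule split[OF _ _ _ that])
        show "torus_continuous v"
          unfolding v_def by (intro torus_continuous_intros f tch tcy)
        show "ip v u = 0" if "u \<in> mono_span A" for u
          using ipv[of u] h(2)[OF that] e(2)[OF that] torus_continuous_mono_span[OF that]
          by (simp add: y_def)
        show "ip v y = 0"
        \<comment> \<open>A null \<open>y\<close> is orthogonal to everything, so the quotient by
          zero in \<open>a\<close> does no harm.\<close>
        proof (cases "ip y y = 0")
          case True
          then show ?thesis
            using ipv[OF tcy] ip_null(2)[OF tcy torus_continuous_diff[OF f tch]] by simp
        qed (simp add: ipv[OF tcy] a_def)
      qed
      moreover have "(\<lambda>z w. h z w + a * y z w) \<in> mono_span (insert x A)"
        using insert.hyps h(1) yA by (intro mono_span_add mono_span_scale) (auto intro: mono_span_subset)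
      moreover have "v = (\<lambda>z w. f z w - (h z w + a * y z w))" by (simp add: v_def algebra_simps)
      ultimately show "\<exists>h\<in>mono_span (insert x A). \<forall>u\<in>mono_span (insert x A). ip (\<lambda>z w. f z w - h z w) u = 0"
        by (intro bexI[of _ "\<lambda>z w. h z w + a * y z w"]) auto
    qed
  qed
  then show ?thesis using that assms(2) by blast
qed

text \<open>A null f is orthogonal to every continuous function, in particular to test functions
  that read off its coefficients.\<close>

lemma mono_span_definite:
  assumes "f \<in> mono_span A" "finite A" "ip f f = 0"
  shows "f = (\<lambda>z w. 0)"
proof -
  obtain a where f: "f = (\<lambda>z w. \<Sum>x\<in>A. a x * mono2 (fst x) (snd x) z w)"
    using assms(1) unfolding mono_span_iff by blast
  have "a (i, j) = 0" if ij: "(i, j) \<in> A" for i j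
  proof -
    \<comment> \<open>The factor |p|^2 cancels the weight, so pairing with \<open>g\<close> is the
      unweighted Fourier coefficient at (i, j).\<close>
    define g where "g = (\<lambda>z w. complex_of_real ((cmod (p z w))\<^sup>2) * mono2 i j z w)"
    interpret one: torus_weight "\<lambda>z w. 1" by unfold_locales (simp_all add: torus_continuous_const)
    have "ip f g = one.ip f (mono2 i j)"
      unfolding ip_eq_mean one.ip_eq_mean
      by (rule torus_mean_cong) (simp add: g_def weight_nonzero)
    also have "\<dots> = (\<Sum>x\<in>A. a x * one.ip (mono2 (fst x) (snd x)) (mono2 i j))"
      unfolding f by (rule one.ip_sum_left) (auto intro!: torus_continuous_mono2)
    also have "\<dots> = (\<Sum>x\<in>A. if x = (i, j) then a x else 0)"
      unfolding one.ip_eq_mean by (rule sum.cong) (use torus_mean_mono2 in auto)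
    also have "\<dots> = a (i, j)" using assms(2) ij by simp
    finally have "ip f g = a (i, j)" .
    moreover have "torus_continuous g"
      unfolding g_def by (intro torus_continuous_intros weight_continuous)
    ultimately show ?thesis
      using ip_null(1)[OF torus_continuous_mono_span[OF assms(1)] _ assms(3)] by simp
  qed
  then show ?thesis by (auto simp: f fun_eq_iff intro!: sum.neutral)
qed

text \<open>The values are the unweighted Fourier coefficients of \<open>f / \<bar>p\<bar>\<^sup>2\<close>, so Bessel's inequality applies.\<close>
lemma ip_mono2_tendsto_zero:
  assumes f: "torus_continuous f"
  shows "(\<lambda>s. ip f (mono2 i s)) \<longlonglongrightarrow> 0"
proof -
  interpret one: torus_weight "\<lambda>z w. 1" by unfold_locales (simp_all add: torus_continuous_const)
  define F where "F = (\<lambda>z w. f z w / complex_of_real ((cmod (p z w))\<^sup>2))"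
  have tcF: "torus_continuous F"
    unfolding F_def using weight_nonzero
    by (intro torus_continuous_divide torus_continuous_intros f weight_continuous) auto
  define b where "b s = one.ip F (mono2 i s)" for s
  have b: "ip f (mono2 i s) = b s" for s
    unfolding b_def ip_eq_mean one.ip_eq_mean by (rule torus_mean_cong) (simp add: F_def)
  have orth: "one.ip (mono2 i s) (mono2 i t) = (if s = t then 1 else 0)" for s t
    using torus_mean_mono2[of i s i t] by (simp add: one.ip_eq_mean)
  have "(\<Sum>s<N. (cmod (b s))\<^sup>2) \<le> Re (one.ip F F)" for N
  proof -
    define h where "h = (\<lambda>z w. \<Sum>s<N. b s * mono2 i s z w)"
    have tch: "torus_continuous h" unfolding h_def by (intro torus_continuous_intros)
    have Fh: "one.ip F h = of_real (\<Sum>s<N. (cmod (b s))\<^sup>2)"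
    proof -
      have "one.ip F h = (\<Sum>t<N. cnj (b t) * b t)"
        unfolding h_def b_def by (intro one.ip_sum_right torus_continuous_mono2 tcF)
      then show ?thesis by (simp add: complex_norm_square mult.commute del: of_real_power)
    qed
    have "one.ip (mono2 i s) h = cnj (b s)" if "s < N" for s
    proof -
      have "one.ip (mono2 i s) h = (\<Sum>t<N. cnj (b t) * one.ip (mono2 i s) (mono2 i t))"
        unfolding h_def by (intro one.ip_sum_right torus_continuous_mono2)
      also have "\<dots> = (\<Sum>t<N. if t = s then cnj (b t) else 0)"
        by (rule sum.cong) (simp_all add: orth)
      finally show ?thesis using that by simp
    qed
    moreover have "one.ip h h = (\<Sum>t<N. b t * one.ip (mono2 i t) h)"
      by (subst (1) h_def) (intro one.ip_sum_left torus_continuous_mono2 tch)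
    ultimately have hh: "one.ip h h = of_real (\<Sum>s<N. (cmod (b s))\<^sup>2)"
      by (simp add: complex_norm_square del: of_real_power)
    have "one.ip (\<lambda>z w. F z w - 1 * h z w) (\<lambda>z w. F z w - 1 * h z w) = one.ip F F - one.ip F h - one.ip h F + one.ip h h"
      unfolding one.ip_diff_scale_self[OF tcF tch] by simp
    moreover have "one.ip h F = one.ip F h" using one.ip_cnj[of F h] by (simp add: Fh)
    ultimately show ?thesis
      using one.ip_self(2)[OF torus_continuous_diff[OF tcF tch]] by (simp add: Fh hh)
  qed
  then have "summable (\<lambda>s. (cmod (b s))\<^sup>2)"
    by (intro summableI_nonneg_bounded) auto
  then have "(\<lambda>s. sqrt ((cmod (b s))\<^sup>2)) \<longlonglongrightarrow> sqrt 0"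
    by (intro tendsto_real_sqrt summable_LIMSEQ_zero)
  then have "b \<longlonglongrightarrow> 0" by (simp add: tendsto_norm_zero_iff)
  then show ?thesis by (simp add: b)
qed

text \<open>On the torus both reflected functions are the same unimodular monomial times a
  conjugate. Dropping the monomial leaves a pairing of conjugates, in which the two arguments change
  roles.\<close>

lemma ip_reflect:
  assumes "\<And>z w. cmod z = 1 \<Longrightarrow> cmod w = 1 \<Longrightarrow> g z w = mono2 N M z w * cnj (f z w)" "k \<le> N" "l \<le> M"
  shows "ip g (mono2 (N - k) (M - l)) = ip (mono2 k l) f"
proof -
  have "ip g (mono2 (N - k) (M - l))
      = ip (\<lambda>z w. mono2 N M z w * cnj (f z w)) (\<lambda>z w. mono2 N M z w * cnj (mono2 k l z w))"
  proof (rule ip_cong)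
    fix z w :: complex assume zw: "cmod z = 1" "cmod w = 1"
    then have "z \<noteq> 0" "w \<noteq> 0" by auto
    then show "mono2 (N - k) (M - l) z w = mono2 N M z w * cnj (mono2 k l z w)"
      using assms(2,3) zw by (simp add: cnj_unimodular power_diff divide_inverse power_inverse)
  qed (rule assms(1))
  also have "\<dots> = ip (\<lambda>z w. cnj (f z w)) (\<lambda>z w. cnj (mono2 k l z w))"
    by (rule ip_unimodular) (simp add: norm_mult norm_power)
  also have "\<dots> = ip (mono2 k l) f" by (simp add: ip_eq_mean mult.commute)
  finally show ?thesis .
qed

lemma ip_sym_zero: "ip f g = 0 \<longleftrightarrow> ip g f = 0"
  using ip_cnj[of f g] by auto

lemma ip_sum3_zero:
  assumes "torus_continuous g" "torus_continuous h" "torus_continuous k" "torus_continuous x"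
    "ip g x = 0" "ip h x = 0" "ip k x = 0"
  shows "ip (\<lambda>z w. a * g z w + h z w + k z w) x = 0"
proof -
  have g: "torus_continuous (\<lambda>z w. a * g z w)"
    by (intro torus_continuous_intros assms)
  have gh: "torus_continuous (\<lambda>z w. a * g z w + h z w)"
    by (intro torus_continuous_add g assms)
  show ?thesis
    using ip_add_left[OF gh assms(3,4)] ip_add_left[OF g assms(2,4)] ip_scale_left[of a g x] assms(5-)
    by simp
qed

lemma ip_combination_zero:
  assumes "torus_continuous f" "torus_continuous g" "torus_continuous h" "torus_continuous k"
    "torus_continuous x" "ip f x = 0" "ip g x = 0" "ip h x = 0" "ip k x = 0"
  shows "ip (\<lambda>z w. f z w - (a * g z w + h z w + k z w)) x = 0"
proof -
  have "torus_continuous (\<lambda>z w. a * g z w + h z w + k z w)"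
    by (intro torus_continuous_add torus_continuous_mult torus_continuous_const assms)
  from ip_diff_left[OF assms(1) this assms(5)] show ?thesis
    by (simp only: ip_sum3_zero[OF assms(2-5,7-9)] assms(6) diff_self)
qed

lemma ip_span_zero_right:
  assumes "g \<in> mono_span A" "torus_continuous f" "\<And>i j. (i, j) \<in> A \<Longrightarrow> ip f (mono2 i j) = 0"
  shows "ip f g = 0"
proof -
  have "ip g f = 0"
    by (rule ip_span_zero[OF assms(1,2)]) (simp add: ip_sym_zero[of _ f] assms(3))
  then show ?thesis by (simp add: ip_sym_zero[of f])
qed

section \<open>Reproducing kernels of spaces with an orthonormal basis\<close>

lemma repr_kernel_span:
  assumes "is_onb ip V es" "V \<subseteq> mono_span A"
  shows "(\<lambda>z w. repr_kernel es z w z1 w1) \<in> mono_span A"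
proof -
  have "es ! k \<in> mono_span A" if "k < length es" for k
    using assms that by (auto simp: is_onb_def)
  then have "(\<lambda>z w. \<Sum>k<length es. cnj ((es ! k) z1 w1) * (es ! k) z w) \<in> mono_span A"
    by (intro mono_span_sum mono_span_scale) auto
  then show ?thesis by (simp add: repr_kernel_def mult.commute)
qed

lemma ip_repr_kernel:
  assumes "is_onb ip V es" "V \<subseteq> mono_span A" "torus_continuous f"
  shows "ip f (\<lambda>z w. repr_kernel es z w z1 w1) = (\<Sum>k<length es. (es ! k) z1 w1 * ip f (es ! k))"
proof -
  have "torus_continuous (es ! k)" if "k < length es" for k
    using assms that by (intro torus_continuous_mono_span[of _ A]) (auto simp: is_onb_def)
  then have "ip f (\<lambda>z w. \<Sum>k<length es. cnj ((es ! k) z1 w1) * (es ! k) z w)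
      = (\<Sum>k<length es. cnj (cnj ((es ! k) z1 w1)) * ip f (es ! k))"
    by (intro ip_sum_right assms(3)) auto
  then show ?thesis by (simp add: repr_kernel_def mult.commute)
qed

lemma ip_repr_kernel_orth:
  assumes "is_onb ip V es" "V \<subseteq> mono_span A" "torus_continuous f" "\<And>g. g \<in> V \<Longrightarrow> ip f g = 0"
  shows "ip f (\<lambda>z w. repr_kernel es z w z1 w1) = 0"
  using assms(1,4) by (subst ip_repr_kernel[OF assms(1-3)]) (simp add: is_onb_def)

text \<open>Orthonormality identifies the coefficients of f in the basis with its inner products;
  the inclusion in \<open>mono_span A\<close> supplies continuity on the torus.\<close>

lemma ip_repr_kernel_reproducing:
  assumes "is_onb ip V es" "V \<subseteq> mono_span A" "f \<in> V"
  shows "ip f (\<lambda>z w. repr_kernel es z w z1 w1) = f z1 w1"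
proof -
  have tce: "torus_continuous (es ! k)" if "k < length es" for k
    using assms that by (intro torus_continuous_mono_span[of _ A]) (auto simp: is_onb_def)
  have tcf: "torus_continuous f"
    using assms by (intro torus_continuous_mono_span[of _ A]) auto
  obtain a where a: "f = (\<lambda>z w. \<Sum>k<length es. a k * (es ! k) z w)"
    using assms by (auto simp: is_onb_def)
  have "ip f (es ! l) = a l" if "l < length es" for l
  proof -
    have "ip f (es ! l) = (\<Sum>k<length es. a k * ip (es ! k) (es ! l))"
      unfolding a using tce that by (intro ip_sum_left) auto
    also have "\<dots> = (\<Sum>k<length es. if k = l then a k else 0)"
      using assms(1) that by (intro sum.cong) (auto simp: is_onb_def)
    finally show ?thesis using that by simp
  qed
  then have "ip f (\<lambda>z w. repr_kernel es z w z1 w1) = (\<Sum>k<length es. (es ! k) z1 w1 * a k)"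
    by (simp add: ip_repr_kernel[OF assms(1,2) tcf])
  also have "\<dots> = f z1 w1" by (simp add: a mult.commute)
  finally show ?thesis .
qed

lemma ip_orth3:
  assumes f: "torus_continuous f1" "torus_continuous f2" "torus_continuous f3"
    and g: "torus_continuous g1" "torus_continuous g2" "torus_continuous g3"
    and "ip f1 g2 = 0" "ip f1 g3 = 0" "ip f2 g1 = 0" "ip f2 g3 = 0" "ip f3 g1 = 0" "ip f3 g2 = 0"
  shows "ip (\<lambda>z w. f1 z w + f2 z w + f3 z w) (\<lambda>z w. g1 z w + g2 z w + g3 z w)
    = ip f1 g1 + ip f2 g2 + ip f3 g3"
proof -
  have split: "ip h (\<lambda>z w. g1 z w + g2 z w + g3 z w) = ip h g1 + ip h g2 + ip h g3"
    if h: "torus_continuous h" for h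
    using ip_add_right[OF torus_continuous_add[OF g(1,2)] g(3) h] ip_add_right[OF g(1,2) h]
    by (simp only:)
  have G: "torus_continuous (\<lambda>z w. g1 z w + g2 z w + g3 z w)"
    by (intro torus_continuous_add g)
  show ?thesis
    using ip_add_left[OF torus_continuous_add[OF f(1,2)] f(3) G] ip_add_left[OF f(1,2) G]
      split[OF f(1)] split[OF f(2)] split[OF f(3)] assms(7-) by simp
qed

lemma orth_compl_scale: "h \<in> orth_compl ip (mono_span A) B \<Longrightarrow> (\<lambda>z w. a * h z w) \<in> orth_compl ip (mono_span A) B"
  by (auto simp: orth_compl_iff ip_scale_left mono_span_scale)

lemma repr_kernel_orth_compl:
  assumes "is_onb ip (orth_compl ip (mono_span A) (mono_span B)) es"
  shows "(\<lambda>z w. repr_kernel es z w z1 w1) \<in> orth_compl ip (mono_span A) (mono_span B)"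
proof -
  have sub: "orth_compl ip (mono_span A) (mono_span B) \<subseteq> mono_span A"
    by (auto simp: orth_compl_iff)
  have "ip u (\<lambda>z w. repr_kernel es z w z1 w1) = 0" if "u \<in> mono_span B" for u
    using that
    by (intro ip_repr_kernel_orth[OF assms sub torus_continuous_mono_span[OF that]])
      (auto simp: orth_compl_iff ip_sym_zero[of u])
  then have "ip (\<lambda>z w. repr_kernel es z w z1 w1) u = 0" if "u \<in> mono_span B" for u
    using that by (subst ip_sym_zero)
  then show ?thesis
    using repr_kernel_span[OF assms sub] by (simp add: orth_compl_iff)
qed

end

lemma torus_mean_sum:
  assumes "\<And>x. x \<in> A \<Longrightarrow> torus_continuous (f x)"
  shows "torus_mean (\<lambda>z w. \<Sum>x\<in>A. a x * f x z w) = (\<Sum>x\<in>A. a x * torus_mean (f x))"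
proof -
  interpret one: torus_weight "\<lambda>z w. 1" by unfold_locales (simp_all add: torus_continuous_const)
  show ?thesis
    using one.ip_sum_left[where f = f and a = a and g = "\<lambda>z w. 1", OF assms torus_continuous_const]
    by (simp add: one.ip_eq_mean)
qed

text \<open>One root r of q is split off at a time. The cofactor, applied to x as a polynomial in
  the forward shift, gives a sequence multiplied by r at each step; as |r| > 1, boundedness makes it
  vanish, and the cofactor has smaller degree. \<open>N\<close> is only a bound for the degree,
  since top coefficients of the later q may vanish.\<close>

lemma bounded_recurrence_zero:
  fixes q :: "complex poly" and x :: "nat \<Rightarrow> complex"
  assumes "degree q \<le> N" "\<And>r. cmod r \<le> 1 \<Longrightarrow> poly q r \<noteq> 0"
    and "\<And>l. cmod (x l) \<le> B" "\<And>l. (\<Sum>t\<le>N. coeff q t * x (l + t)) = 0"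
  shows "x l = 0"
  using assms
proof (induction N arbitrary: q)
  case 0
  have "coeff q 0 \<noteq> 0" using "0.prems"(2)[of 0] by (simp add: poly_0_coeff_0)
  then show ?case using "0.prems"(4)[of l] by simp
next
  case (Suc N)
  show ?case
  proof (cases "degree q = 0")
    case True
    then have "coeff q t = 0" if "t > 0" for t using that by (simp add: coeff_eq_0)
    then have "(\<Sum>t\<le>Suc N. coeff q t * x (l + t)) = coeff q 0 * x l"
      by (subst sum.atMost_Suc_shift) simp
    moreover have "coeff q 0 \<noteq> 0" using Suc.prems(2)[of 0] by (simp add: poly_0_coeff_0)
    ultimately show ?thesis using Suc.prems(4)[of l] by simp
  next
    case False
    then have "\<not> constant (poly q)" by (simp add: constant_degree)
    then obtain r where r: "poly q r = 0" using fundamental_theorem_of_algebra by blast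
    then obtain q' where q: "q = [:- r, 1:] * q'" by (metis dvdE poly_eq_0_iff_dvd)
    have "q' \<noteq> 0" using False q by auto
    then have "degree q = Suc (degree q')" unfolding q by (subst degree_mult_eq) auto
    then have d: "degree q' \<le> N" using Suc.prems(1) by simp
    have r1: "cmod r > 1" using r Suc.prems(2)[of r] by force
    define y where "y l = (\<Sum>t\<le>N. coeff q' t * x (l + t))" for l
    have "y (Suc l) = r * y l" for l
    proof -
      have "q = pCons 0 q' - smult r q'" by (simp add: q)
      then have "0 = (\<Sum>t\<le>Suc N. coeff (pCons 0 q') t * x (l + t)) - (\<Sum>t\<le>Suc N. r * coeff q' t * x (l + t))"
        using Suc.prems(4)[of l] by (simp add: left_diff_distrib sum_subtractf)
      also have "(\<Sum>t\<le>Suc N. coeff (pCons 0 q') t * x (l + t)) = y (Suc l)"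
        unfolding y_def by (subst sum.atMost_Suc_shift) simp
      also have "(\<Sum>t\<le>Suc N. r * coeff q' t * x (l + t)) = r * y l"
        using d by (simp add: y_def coeff_eq_0 sum_distrib_left mult.assoc)
      finally show ?thesis by simp
    qed
    then have pow: "y (l + k) = r ^ k * y l" for l k by (induction k) auto
    have bnd: "cmod (y l) \<le> (\<Sum>t\<le>N. cmod (coeff q' t) * B)" for l
      unfolding y_def by (intro sum_norm_le) (simp add: norm_mult mult_left_mono Suc.prems(3))
    have "y l = 0" for l
    proof (rule ccontr)
      assume "y l \<noteq> 0"
      then obtain k where "(\<Sum>t\<le>N. cmod (coeff q' t) * B) / cmod (y l) < cmod r ^ k"
        using real_arch_pow[OF r1] by blast
      then have "(\<Sum>t\<le>N. cmod (coeff q' t) * B) < cmod (y (l + k))"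
        using \<open>y l \<noteq> 0\<close>
        by (subst pow) (simp add: norm_mult norm_power pos_divide_less_eq)
      then show False using bnd[of "l + k"] by simp
    qed
    moreover have "poly q' u \<noteq> 0" if "cmod u \<le> 1" for u
      using Suc.prems(2)[OF that] by (simp add: q)
    ultimately show ?thesis
      using Suc.IH[OF d _ Suc.prems(3)] by (simp add: y_def)
  qed
qed

section \<open>Stable polynomials and their Gram matrices\<close>

locale stable_bipoly =
  fixes c :: "nat \<Rightarrow> nat \<Rightarrow> complex" and n m :: nat
  assumes n_pos: "1 \<le> n" and m_pos: "1 \<le> m" and stable: "stable2 (bipoly c n m)"
begin

abbreviation p :: "complex \<Rightarrow> complex \<Rightarrow> complex" where "p \<equiv> bipoly c n m"
abbreviation pt :: "complex \<Rightarrow> complex \<Rightarrow> complex" where "pt \<equiv> bipoly_refl c n m"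

lemma p_nonzero: "cmod z \<le> 1 \<Longrightarrow> cmod w \<le> 1 \<Longrightarrow> p z w \<noteq> 0"
  using stable by (simp add: stable2_def)

lemma p_span: "p \<in> mono_span ({0..n} \<times> {0..m})"
proof -
  have "p = (\<lambda>z w. \<Sum>i\<le>n. \<Sum>j\<le>m. c i j * mono2 i j z w)"
    by (simp add: fun_eq_iff bipoly_def mult.assoc)
  also have "\<dots> \<in> mono_span ({0..n} \<times> {0..m})"
    by (intro mono_span_sum mono_span_scale mono_span_mono2) auto
  finally show ?thesis .
qed

lemma pt_span: "pt \<in> mono_span ({0..n} \<times> {0..m})"
proof -
  have "pt = (\<lambda>z w. \<Sum>i\<le>n. \<Sum>j\<le>m. cnj (c i j) * mono2 (n - i) (m - j) z w)"
    by (simp add: fun_eq_iff bipoly_refl_def mult.assoc)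
  also have "\<dots> \<in> mono_span ({0..n} \<times> {0..m})"
    by (intro mono_span_sum mono_span_scale mono_span_mono2) auto
  finally show ?thesis .
qed

end

sublocale stable_bipoly \<subseteq> torus_weight p
  by unfold_locales (simp_all add: torus_continuous_mono_span[OF p_span] p_nonzero)

context stable_bipoly
begin

section \<open>Fourier coefficients of 1/p and inner products with p and its reflection\<close>

lemma pt_torus:
  assumes "cmod z = 1" "cmod w = 1"
  shows "pt z w = mono2 n m z w * cnj (p z w)"
proof -
  have *: "x ^ (k - i) = x ^ k * cnj x ^ i" if "cmod x = 1" "i \<le> k" for x :: complex and k i :: nat
  proof -
    have "x \<noteq> 0" using that by auto
    then show ?thesis using that by (simp add: cnj_unimodular power_diff power_inverse divide_inverse)
  qed
  have "pt z w = (\<Sum>i\<le>n. \<Sum>j\<le>m. z ^ n * w ^ m * (cnj (c i j) * cnj z ^ i * cnj w ^ j))"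
    unfolding bipoly_refl_def using assms by (intro sum.cong) (auto simp: *)
  then show ?thesis by (simp add: bipoly_def sum_distrib_left)
qed

text \<open>The Fourier coefficient of 1/p at (-k, -l), hence the Taylor coefficient of 1/p at
  z^(-k) w^(-l). The sign is chosen so that multiplication by a monomial adds its exponents to the
  indices.\<close>

definition alpha :: "int \<Rightarrow> int \<Rightarrow> complex" where
  "alpha k l = torus_mean (\<lambda>z w. z powi k * w powi l / p z w)"

lemma alpha_continuous: "torus_continuous (\<lambda>z w. z powi k * w powi l / p z w)"
  using weight_nonzero
  by (intro torus_continuous_divide torus_continuous_mult torus_continuous_powi
      torus_continuous_fst torus_continuous_snd weight_continuous) auto

lemma p_holomorphic: "(\<lambda>z. p z w) holomorphic_on S" "(\<lambda>w. p z w) holomorphic_on S"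
  unfolding bipoly_def by (intro holomorphic_intros)+

text \<open>With the other variable fixed on the circle, 1/p is holomorphic on the closed disc in
  the variable whose exponent is positive.\<close>

lemma alpha_zero:
  assumes "k > 0 \<or> l > 0"
  shows "alpha k l = 0"
  using assms unfolding alpha_def
proof
  assume k: "k > 0"
  show "torus_mean (\<lambda>z w. z powi k * w powi l / p z w) = 0"
  proof (rule torus_mean_holomorphic_fst[OF alpha_continuous])
    fix w :: complex assume "cmod w = 1"
    then show "\<exists>h. h holomorphic_on cball 0 1 \<and> (\<forall>z. cmod z = 1 \<longrightarrow> z powi k * w powi l / p z w = z * h z)"
      using k p_nonzero by (intro exI[of _ "\<lambda>z. z ^ (nat k - 1) * w powi l / p z w"])
        (auto intro!: holomorphic_intros p_holomorphic simp: power_int_def simp flip: power_Suc mult.assoc)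
  qed
next
  assume l: "l > 0"
  show "torus_mean (\<lambda>z w. z powi k * w powi l / p z w) = 0"
  proof (rule torus_mean_holomorphic_snd[OF alpha_continuous])
    fix z :: complex assume "cmod z = 1"
    then show "\<exists>h. h holomorphic_on cball 0 1 \<and> (\<forall>w. cmod w = 1 \<longrightarrow> z powi k * w powi l / p z w = w * h w)"
      using l p_nonzero by (intro exI[of _ "\<lambda>w. w ^ (nat l - 1) * z powi k / p z w"])
        (auto intro!: holomorphic_intros p_holomorphic simp: power_int_def mult_ac
          simp flip: power_Suc power_Suc2 mult.assoc)
  qed
qed

text \<open>Comparison of Fourier coefficients in p (1/p) = 1.\<close>

lemma alpha_sum:
  fixes u v :: int
  shows "(\<Sum>x\<in>{..n} \<times> {..m}. c (fst x) (snd x) * alpha (u + fst x) (v + snd x))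
    = (if u = 0 \<and> v = 0 then 1 else 0)"
proof -
  have "(\<Sum>x\<in>{..n} \<times> {..m}. c (fst x) (snd x) * alpha (u + fst x) (v + snd x))
    = torus_mean (\<lambda>z w. \<Sum>x\<in>{..n} \<times> {..m}. c (fst x) (snd x) * (z powi (u + fst x) * w powi (v + snd x) / p z w))"
    unfolding alpha_def by (rule torus_mean_sum[symmetric]) (rule alpha_continuous)
  also have "\<dots> = torus_mean (\<lambda>z w. z powi u * w powi v)"
  proof (rule torus_mean_cong)
    fix z w :: complex assume zw: "cmod z = 1" "cmod w = 1"
    then have nz: "z \<noteq> 0" "w \<noteq> 0" "p z w \<noteq> 0" using weight_nonzero by auto
    have "(\<Sum>x\<in>{..n} \<times> {..m}. c (fst x) (snd x) * (z powi (u + fst x) * w powi (v + snd x) / p z w))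
      = (\<Sum>x\<in>{..n} \<times> {..m}. z powi u * w powi v / p z w * (c (fst x) (snd x) * z ^ fst x * w ^ snd x))"
      using nz by (intro sum.cong) (auto simp: power_int_add)
    also have "\<dots> = z powi u * w powi v / p z w * p z w"
      unfolding sum_distrib_left[symmetric]
      by (simp add: bipoly_def sum.cartesian_product case_prod_unfold)
    finally show "(\<Sum>x\<in>{..n} \<times> {..m}. c (fst x) (snd x) * (z powi (u + fst x) * w powi (v + snd x) / p z w))
      = z powi u * w powi v" using nz by simp
  qed
  finally show ?thesis by (simp add: torus_mean_powi)
qed

text \<open>The conjugate of p cancels one factor of the weight and leaves 1/p.\<close>

lemma ip_mono_p: "ip (mono2 k l) (\<lambda>z w. mono2 a b z w * p z w) = alpha (int k - int a) (int l - int b)"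
  unfolding ip_eq_mean alpha_def
proof (rule torus_mean_cong)
  fix z w :: complex assume zw: "cmod z = 1" "cmod w = 1"
  have "mono2 k l z w * cnj (mono2 a b z w * p z w) / of_real ((cmod (p z w))\<^sup>2)
      = mono2 k l z w * cnj (mono2 a b z w) * (cnj (p z w) / (p z w * cnj (p z w)))"
    by (simp only: complex_norm_square complex_cnj_mult times_divide_eq_right mult.assoc)
  also have "\<dots> = z powi (int k - int a) * w powi (int l - int b) / p z w"
    using weight_nonzero[OF zw] by (simp only: mono2_cnj_torus[OF zw]) simp
  finally show "mono2 k l z w * cnj (mono2 a b z w * p z w) / of_real ((cmod (p z w))\<^sup>2)
      = z powi (int k - int a) * w powi (int l - int b) / p z w" .
qed

text \<open>On the torus the conjugate of \<open>pt\<close> is z^(-n) w^(-m) p, so the weight leaves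
  1 over the conjugate of p and a conjugated coefficient appears.\<close>

lemma ip_mono_pt: "ip (mono2 k l) (\<lambda>z w. mono2 a b z w * pt z w)
    = cnj (alpha (int (n + a) - int k) (int (m + b) - int l))"
  unfolding ip_eq_mean alpha_def torus_mean_cnj[symmetric]
proof (rule torus_mean_cong)
  fix z w :: complex assume zw: "cmod z = 1" "cmod w = 1"
  have "mono2 k l z w * cnj (mono2 a b z w * pt z w) / of_real ((cmod (p z w))\<^sup>2)
      = cnj (mono2 (n + a) (m + b) z w * cnj (mono2 k l z w)) * (p z w / (p z w * cnj (p z w)))"
    by (simp add: pt_torus[OF zw] complex_norm_square power_add mult_ac del: of_real_power)
  also have "\<dots> = cnj (z powi (int (n + a) - int k) * w powi (int (m + b) - int l) / p z w)"
    using weight_nonzero[OF zw] by (simp only: mono2_cnj_torus[OF zw]) simp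
  finally show "mono2 k l z w * cnj (mono2 a b z w * pt z w) / of_real ((cmod (p z w))\<^sup>2)
      = cnj (z powi (int (n + a) - int k) * w powi (int (m + b) - int l) / p z w)" .
qed

lemma ip_p_orth: "0 < k \<or> 0 < l \<Longrightarrow> ip (mono2 k l) p = 0"
  using ip_mono_p[of k l 0 0] by (auto simp: alpha_zero)

lemma ip_pt_orth: "k < n \<or> l < m \<Longrightarrow> ip (mono2 k l) pt = 0"
  using ip_mono_pt[of k l 0 0] by (auto simp: alpha_zero)

lemma ip_p_self: "ip p p = 1"
proof -
  have "ip p p = torus_mean (\<lambda>z w. 1)" unfolding ip_eq_mean
    by (rule torus_mean_cong) (simp add: complex_norm_square[symmetric] weight_nonzero)
  then show ?thesis by (simp add: torus_mean_1)
qed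

lemma ip_pt_self: "ip pt pt = 1"
proof -
  have "ip pt pt = ip (\<lambda>z w. mono2 n m z w * cnj (p z w)) (\<lambda>z w. mono2 n m z w * cnj (p z w))"
    by (rule ip_cong) (simp_all add: pt_torus)
  also have "\<dots> = ip (\<lambda>z w. cnj (p z w)) (\<lambda>z w. cnj (p z w))"
    by (rule ip_unimodular) (simp add: norm_mult norm_power)
  also have "\<dots> = ip p p" by (simp add: ip_eq_mean mult.commute)
  finally show ?thesis by (simp add: ip_p_self)
qed

section \<open>The Gohberg-Semencul dual basis in z\<close>

definition wcoeff :: "nat \<Rightarrow> complex \<Rightarrow> complex" where
  "wcoeff a w = (\<Sum>t\<le>m. c a t * w ^ t)"

text \<open>For |w| = 1 this is w^m times the conjugate of \<open>wcoeff a w\<close>; the power of w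
  keeps it a polynomial.\<close>

definition wcoeff_refl :: "nat \<Rightarrow> complex \<Rightarrow> complex" where
  "wcoeff_refl a w = (\<Sum>t\<le>m. cnj (c a t) * w ^ (m - t))"

lemma p_wcoeff: "p z w = (\<Sum>a\<le>n. z ^ a * wcoeff a w)"
  by (simp add: bipoly_def wcoeff_def sum_distrib_left mult_ac)

lemma pt_wcoeff: "pt z w = (\<Sum>a\<le>n. z ^ a * wcoeff_refl (n - a) w)"
  unfolding bipoly_refl_def
  by (subst sum.atLeastAtMost_rev[of _ 0 n, simplified atLeast0AtMost])
     (simp add: wcoeff_refl_def sum_distrib_left mult_ac)

text \<open>For fixed w on the circle, w^(-m) \<open>dual i\<close> is the Gohberg-Semencul
  expression for the basis dual to 1, z, ..., z^(n-1) under the weight 1/|p|^2: there w^(-m)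
  \<open>wcoeff_refl b\<close> is the conjugate coefficient of p and w^(-m) \<open>pt\<close> its
  reflection in z alone. Clearing w^(-m) causes the offset m in all later indices.\<close>

definition dual :: "nat \<Rightarrow> complex \<Rightarrow> complex \<Rightarrow> complex" where
  "dual i z w = (\<Sum>b\<le>i. z ^ (i - b) * (wcoeff_refl b w * p z w - wcoeff (n - b) w * pt z w))"

lemma dual_wcoeff_sum:
  "dual i z w = (\<Sum>(a, b)\<in>{..n} \<times> {..i}. z ^ (i + a - b) *
    (wcoeff_refl b w * wcoeff a w - wcoeff (n - b) w * wcoeff_refl (n - a) w))"
proof -
  have "z ^ (i - b) * (wcoeff_refl b w * p z w - wcoeff (n - b) w * pt z w)
      = (\<Sum>a\<le>n. z ^ (i + a - b) * (wcoeff_refl b w * wcoeff a w - wcoeff (n - b) w * wcoeff_refl (n - a) w))"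
    if "b \<le> i" for b
  proof -
    have "z ^ (i + a - b) = z ^ (i - b) * z ^ a" for a
      using that by (simp flip: power_add)
    then show ?thesis
      by (simp add: p_wcoeff pt_wcoeff sum_distrib_left sum_subtractf[symmetric] algebra_simps)
  qed
  then have "dual i z w = (\<Sum>b\<le>i. \<Sum>a\<le>n. z ^ (i + a - b) *
      (wcoeff_refl b w * wcoeff a w - wcoeff (n - b) w * wcoeff_refl (n - a) w))"
    by (simp add: dual_def)
  then show ?thesis
    by (subst sum.cartesian_product[symmetric], subst sum.swap)
qed

text \<open>The reflection \<open>(a, b) \<mapsto> (n - b, n - a)\<close> shows that the terms of degree at least \<open>n\<close> in \<open>z\<close> cancel.\<close>
lemma dual_span:
  assumes "i < n"
  shows "dual i \<in> mono_span ({0..<n} \<times> {0..2 * m})"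
proof -
  define H where "H = {(a, b). a \<le> n \<and> b \<le> i \<and> n + b \<le> i + a}"
  define L where "L = {(a, b). a \<le> n \<and> b \<le> i \<and> i + a < n + b}"
  let ?t = "\<lambda>z w (a, b). z ^ (i + a - b) *
    (wcoeff_refl b w * wcoeff a w - wcoeff (n - b) w * wcoeff_refl (n - a) w)"
  have fin: "finite H" "finite L"
    by (rule finite_subset[of _ "{..n} \<times> {..i}"]; auto simp: H_def L_def)+
  have HL: "{..n} \<times> {..i} = H \<union> L" "H \<inter> L = {}" by (auto simp: H_def L_def)
  have "(\<Sum>x\<in>H. z ^ (i + fst x - snd x) * (wcoeff_refl (snd x) w * wcoeff (fst x) w))
      = (\<Sum>x\<in>H. z ^ (i + fst x - snd x) * (wcoeff (n - snd x) w * wcoeff_refl (n - fst x) w))" for z w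
    by (rule sum.reindex_bij_witness[of _ "\<lambda>x. (n - snd x, n - fst x)" "\<lambda>x. (n - snd x, n - fst x)"])
      (use assms in \<open>auto simp: H_def mult.commute intro!: arg_cong[where f = "\<lambda>k. _ ^ k"]\<close>)
  then have "(\<Sum>x\<in>H. ?t z w x) = 0" for z w
    by (simp add: case_prod_unfold right_diff_distrib sum_subtractf)
  then have "dual i = (\<lambda>z w. \<Sum>x\<in>L. ?t z w x)"
    unfolding fun_eq_iff dual_wcoeff_sum HL(1) by (simp add: sum.union_disjoint fin HL(2))
  also have "\<dots> \<in> mono_span ({0..<n} \<times> {0..2 * m})"
  proof (rule mono_span_sum)
    fix x assume "x \<in> L"
    obtain a b where x: "x = (a, b)" by fastforce
    have k: "i + a - b < n" using \<open>x \<in> L\<close> assms by (auto simp: L_def x)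
    have W: "(\<lambda>z w. wcoeff k w) \<in> mono_span ({0} \<times> {0..m})" for k
    proof -
      have "(\<lambda>z w. wcoeff k w) = (\<lambda>z w. \<Sum>t\<le>m. c k t * mono2 0 t z w)"
        by (simp add: wcoeff_def)
      also have "\<dots> \<in> mono_span ({0} \<times> {0..m})"
        by (intro mono_span_sum mono_span_scale mono_span_mono2) auto
      finally show ?thesis .
    qed
    have R: "(\<lambda>z w. wcoeff_refl k w) \<in> mono_span ({0} \<times> {0..m})" for k
    proof -
      have "(\<lambda>z w. wcoeff_refl k w) = (\<lambda>z w. \<Sum>t\<le>m. cnj (c k t) * mono2 0 (m - t) z w)"
        by (simp add: wcoeff_refl_def)
      also have "\<dots> \<in> mono_span ({0} \<times> {0..m})"
        by (intro mono_span_sum mono_span_scale mono_span_mono2) auto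
      finally show ?thesis .
    qed
    have "(\<lambda>z w. wcoeff_refl b w * wcoeff a w - wcoeff (n - b) w * wcoeff_refl (n - a) w)
        \<in> mono_span ({0} \<times> {0..2 * m})"
      by (intro mono_span_diff mono_span_mult[OF R W] mono_span_mult[OF W R]) auto
    then have "(\<lambda>z w. z ^ (i + a - b) * w ^ 0 *
        (wcoeff_refl b w * wcoeff a w - wcoeff (n - b) w * wcoeff_refl (n - a) w))
        \<in> mono_span ({0..<n} \<times> {0..2 * m})"
      by (rule mono_span_shift) (use k in auto)
    then show "(\<lambda>z w. ?t z w x) \<in> mono_span ({0..<n} \<times> {0..2 * m})" by (simp add: x)
  qed
  finally show ?thesis .
qed

text \<open>The Gohberg--Semencul formula: the shifted polynomials \<open>w ^ r * dual i\<close> invert the Gram matrix of the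
  monomials of degree less than \<open>n\<close> in \<open>z\<close>.\<close>
lemma ip_dual:
  assumes "k < n" "i < n"
  shows "ip (mono2 k l) (\<lambda>z w. w ^ r * dual i z w) = (if k = i \<and> l = r + m then 1 else 0)"
proof -
  let ?X = "{..i} \<times> {..m}"
  define f where "f = (\<lambda>x z w. mono2 (i - fst x) (r + (m - snd x)) z w * p z w)"
  define g where "g = (\<lambda>x z w. mono2 (i - fst x) (r + snd x) z w * pt z w)"
  define A where "A = (\<lambda>z w. \<Sum>x\<in>?X. cnj (c (fst x) (snd x)) * f x z w)"
  define B where "B = (\<lambda>z w. \<Sum>x\<in>?X. c (n - fst x) (snd x) * g x z w)"
  have f: "torus_continuous (f x)" and g: "torus_continuous (g x)" for x
    unfolding f_def g_def
    by (intro torus_continuous_mult torus_continuous_mono2 weight_continuous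
        torus_continuous_mono_span[OF pt_span])+
  have A: "torus_continuous A" and B: "torus_continuous B"
    unfolding A_def B_def by (intro torus_continuous_intros f g)+
  have "(\<lambda>z w. w ^ r * dual i z w) = (\<lambda>z w. A z w - B z w)"
    by (simp add: fun_eq_iff dual_def A_def B_def f_def g_def wcoeff_def wcoeff_refl_def
        case_prod_unfold sum_distrib_left sum_distrib_right sum_subtractf right_diff_distrib power_add mult_ac
        sum.cartesian_product)
  then have "ip (mono2 k l) (\<lambda>z w. w ^ r * dual i z w) = ip (mono2 k l) A - ip (mono2 k l) B"
    by (simp only:) (intro ip_diff_right A B torus_continuous_mono2)
  moreover have "ip (mono2 k l) B = 0"
  proof -
    have "ip (mono2 k l) B = (\<Sum>x\<in>?X. cnj (c (n - fst x) (snd x)) * ip (mono2 k l) (g x))"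
      unfolding B_def by (intro ip_sum_right g torus_continuous_mono2)
    \<comment> \<open>The first index of each coefficient is n + (i - fst x) - k, which is positive
      because k < n.\<close>
    then show ?thesis
      using assms by (simp add: g_def ip_mono_pt alpha_zero sum.neutral)
  qed
  moreover have "ip (mono2 k l) A = (if k = i \<and> l = r + m then 1 else 0)"
  proof -
    have "ip (mono2 k l) A = (\<Sum>x\<in>?X. cnj (cnj (c (fst x) (snd x))) * ip (mono2 k l) (f x))"
      unfolding A_def by (intro ip_sum_right f torus_continuous_mono2)
    also have "\<dots> = (\<Sum>x\<in>?X. c (fst x) (snd x) * alpha (int k - int i + fst x) (int l - int (r + m) + snd x))"
      unfolding f_def ip_mono_p by (intro sum.cong refl) (auto simp: of_nat_diff algebra_simps)
    \<comment> \<open>The added terms have fst x > i, so their first index k - i + fst x is positive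
      and they vanish. The completed sum is the convolution of \<open>alpha_sum\<close>.\<close>
    also have "\<dots> = (\<Sum>x\<in>{..n} \<times> {..m}. c (fst x) (snd x) * alpha (int k - int i + fst x) (int l - int (r + m) + snd x))"
      using assms by (intro sum.mono_neutral_left) (auto intro!: alpha_zero)
    finally show ?thesis by (auto simp: alpha_sum)
  qed
  ultimately show ?thesis by simp
qed

section \<open>Orthogonality to all higher powers\<close>

lemma dual_continuous: "i < n \<Longrightarrow> torus_continuous (\<lambda>z w. w ^ r * dual i z w)"
  by (intro torus_continuous_intros torus_continuous_mono_span[OF dual_span])

lemma nrm_dual: "nrm (\<lambda>z w. w ^ r * dual i z w) = nrm (dual i)"
  unfolding nrm_def by (subst ip_unimodular) (simp_all add: norm_power)

text \<open>Biorthogonality turns \<open>dual k\<close>, shifted by s - m, into the functional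
  reading the coefficient of z^k w^s. Only s >= m is reached, since the shift is a natural
  number.\<close>

lemma ip_sum_dual:
  assumes "S \<subseteq> {0..<n} \<times> UNIV" "finite S" "k < n" "m \<le> s"
  shows "ip (\<lambda>z w. \<Sum>x\<in>S. a x * mono2 (fst x) (snd x) z w) (\<lambda>z w. w ^ (s - m) * dual k z w)
    = (if (k, s) \<in> S then a (k, s) else 0)"
proof -
  have "ip (\<lambda>z w. \<Sum>x\<in>S. a x * mono2 (fst x) (snd x) z w) (\<lambda>z w. w ^ (s - m) * dual k z w)
      = (\<Sum>x\<in>S. a x * ip (mono2 (fst x) (snd x)) (\<lambda>z w. w ^ (s - m) * dual k z w))"
    using assms by (intro ip_sum_left torus_continuous_mono2 dual_continuous)
  also have "\<dots> = (\<Sum>x\<in>S. if x = (k, s) then a x else 0)"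
    using assms by (intro sum.cong refl) (subst ip_dual, auto)
  finally show ?thesis using assms(2) by simp
qed

text \<open>Pairing h with itself leaves only the frequencies s in (M, M + m]. There each
  coefficient of h is at most \<open>nrm h * nrm (dual k)\<close>, and one factor
  \<open>nrm h\<close> cancels. The number of terms does not depend on M.\<close>

lemma truncation_bound:
  assumes g: "g \<in> mono_span ({0..<n} \<times> {0..m})"
    and orth: "\<And>i j. i < n \<Longrightarrow> 1 \<le> j \<Longrightarrow> j \<le> m \<Longrightarrow> ip g (mono2 i j) = 0"
    and h: "h \<in> mono_span ({0..<n} \<times> {1..M + m})"
    and proj: "\<And>u. u \<in> mono_span ({0..<n} \<times> {1..M + m}) \<Longrightarrow> ip h u = ip g u"
  shows "nrm h \<le> (\<Sum>k<n. \<Sum>t<m. nrm (dual k) * cmod (ip g (mono2 k (M + Suc t))))"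
proof -
  let ?S = "{0..<n} \<times> {1..M + m}" and ?T = "{0..<n} \<times> {M<..M + m}"
  obtain a where a: "h = (\<lambda>z w. \<Sum>x\<in>?S. a x * mono2 (fst x) (snd x) z w)"
    using h unfolding mono_span_iff by blast
  obtain b where b: "g = (\<lambda>z w. \<Sum>x\<in>{0..<n} \<times> {0..m}. b x * mono2 (fst x) (snd x) z w)"
    using g unfolding mono_span_iff by blast
  note tc = torus_continuous_mono_span
  have coeff: "a (k, s) = ip h (\<lambda>z w. w ^ (s - m) * dual k z w)" if "k < n" "m \<le> s" "s \<le> M + m" for k s
    unfolding a using that m_pos by (subst ip_sum_dual) auto
  \<comment> \<open>The shifted dual has w-degrees between s - m and s + m, inside 1..M + m exactly
    when m < s <= M. Then h may be replaced by g, which has no coefficient at s > m.\<close>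
  have zero: "a (k, s) = 0" if "k < n" "m < s" "s \<le> M" for k s
  proof -
    have "(\<lambda>z w. z ^ 0 * w ^ (s - m) * dual k z w) \<in> mono_span ?S"
      by (rule mono_span_shift[OF dual_span[OF that(1)]]) (use that in auto)
    then have "ip h (\<lambda>z w. w ^ (s - m) * dual k z w) = ip g (\<lambda>z w. w ^ (s - m) * dual k z w)"
      using proj by simp
    also have "\<dots> = 0"
      unfolding b using that by (subst ip_sum_dual) auto
    finally show ?thesis using coeff that by simp
  qed
  have bound: "cmod (a (k, s)) \<le> nrm h * nrm (dual k)" if "k < n" "m \<le> s" "s \<le> M + m" for k s
    using Cauchy_Schwarz[OF tc[OF h] dual_continuous[OF that(1), of "s - m"]] coeff[OF that]
    by (simp add: nrm_dual)
  have "ip h h = ip g h" by (rule proj[OF h])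
  also have "\<dots> = (\<Sum>x\<in>?S. cnj (a x) * ip g (mono2 (fst x) (snd x)))"
    by (subst a) (intro ip_sum_right torus_continuous_mono2 tc[OF g])
  also have "\<dots> = (\<Sum>x\<in>?T. cnj (a x) * ip g (mono2 (fst x) (snd x)))"
  \<comment> \<open>Below the top window, terms with s <= m vanish by orthogonality of g, those with
    m < s <= M by \<open>zero\<close>.\<close>
  proof (rule sum.mono_neutral_right)
    show "\<forall>x\<in>?S - ?T. cnj (a x) * ip g (mono2 (fst x) (snd x)) = 0"
      using orth zero by (force simp: not_le)
  qed auto
  finally have hh: "ip h h = (\<Sum>x\<in>?T. cnj (a x) * ip g (mono2 (fst x) (snd x)))" .
  have "(nrm h)\<^sup>2 = Re (ip h h)"
    using ip_self(2)[OF tc[OF h]] by (simp add: nrm_def)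
  also have "\<dots> \<le> cmod (ip h h)" by (rule complex_Re_le_cmod)
  also have "\<dots> \<le> (\<Sum>x\<in>?T. (nrm h * nrm (dual (fst x))) * cmod (ip g (mono2 (fst x) (snd x))))"
    unfolding hh
  proof (rule sum_norm_le)
    fix x assume x: "x \<in> ?T"
    show "cmod (cnj (a x) * ip g (mono2 (fst x) (snd x)))
        \<le> (nrm h * nrm (dual (fst x))) * cmod (ip g (mono2 (fst x) (snd x)))"
    proof (cases "m \<le> snd x")
      case True
      then show ?thesis using bound[of "fst x" "snd x"] x
        by (auto simp: norm_mult intro!: mult_right_mono)
    next
      case False
      then show ?thesis using orth[of "fst x" "snd x"] x by auto
    qed
  qed
  also have "\<dots> = nrm h * (\<Sum>k<n. \<Sum>s\<in>{M<..M + m}. nrm (dual k) * cmod (ip g (mono2 k s)))"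
    by (simp add: sum.cartesian_product case_prod_unfold sum_distrib_left mult.assoc lessThan_atLeast0)
  also have "(\<Sum>k<n. \<Sum>s\<in>{M<..M + m}. nrm (dual k) * cmod (ip g (mono2 k s)))
      = (\<Sum>k<n. \<Sum>t<m. nrm (dual k) * cmod (ip g (mono2 k (M + Suc t))))"
    by (intro sum.cong refl sum.reindex_bij_witness[of _ "\<lambda>t. M + Suc t" "\<lambda>s. s - Suc M"]) auto
  finally have "nrm h * nrm h \<le> nrm h * (\<Sum>k<n. \<Sum>t<m. nrm (dual k) * cmod (ip g (mono2 k (M + Suc t))))"
    by (simp add: power2_eq_square)
  moreover have "0 \<le> nrm (dual k)" if "k < n" for k
    using that by (intro nrm_nonneg tc[OF dual_span])
  then have "0 \<le> (\<Sum>k<n. \<Sum>t<m. nrm (dual k) * cmod (ip g (mono2 k (M + Suc t))))"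
    by (intro sum_nonneg mult_nonneg_nonneg) auto
  ultimately show ?thesis
    using nrm_nonneg[OF tc[OF h]] by (cases "nrm h = 0") (auto simp: mult_le_cancel_left)
qed

text \<open>For M >= j the monomial lies in the truncated span, so g may be replaced by its
  projection there. The bound on the norm of that projection tends to 0, as it involves a fixed
  number of Fourier coefficients at frequencies beyond M.\<close>

lemma orth_all_powers:
  assumes g: "g \<in> mono_span ({0..<n} \<times> {0..m})"
    and orth: "\<And>i j. i < n \<Longrightarrow> 1 \<le> j \<Longrightarrow> j \<le> m \<Longrightarrow> ip g (mono2 i j) = 0"
    and "i < n" "1 \<le> j"
  shows "ip g (mono2 i j) = 0"
proof -
  define E where "E M = (\<Sum>k<n. \<Sum>t<m. nrm (dual k) * cmod (ip g (mono2 k (M + Suc t))))" for M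
  have tcg: "torus_continuous g" by (rule torus_continuous_mono_span[OF g])
  have "(\<lambda>M. ip g (mono2 k (M + Suc t))) \<longlonglongrightarrow> 0" for k t
    by (rule LIMSEQ_ignore_initial_segment[OF ip_mono2_tendsto_zero[OF tcg]])
  then have "E \<longlonglongrightarrow> (\<Sum>k<n. \<Sum>t<m. nrm (dual k) * cmod 0)"
    unfolding E_def by (intro tendsto_sum tendsto_mult tendsto_norm tendsto_const)
  then have lim: "(\<lambda>M. E M * nrm (mono2 i j)) \<longlonglongrightarrow> 0"
    by (intro tendsto_mult_left_zero) simp
  have "cmod (ip g (mono2 i j)) \<le> E M * nrm (mono2 i j)" if "j \<le> M" for M
  proof -
    let ?S = "{0..<n} \<times> {1..M + m}"
    obtain h where h: "h \<in> mono_span ?S"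
      "\<And>u. u \<in> mono_span ?S \<Longrightarrow> ip (\<lambda>z w. g z w - h z w) u = 0"
      using projection_exists[OF _ tcg, of ?S] by auto
    have tch: "torus_continuous h" by (rule torus_continuous_mono_span[OF h(1)])
    have proj: "ip h u = ip g u" if "u \<in> mono_span ?S" for u
      using h(2)[OF that] ip_diff_left[OF tcg tch torus_continuous_mono_span[OF that]] by simp
    have "mono2 i j \<in> mono_span ?S"
      using assms that by (intro mono_span_mono2) auto
    then have "cmod (ip g (mono2 i j)) \<le> nrm h * nrm (mono2 i j)"
      using Cauchy_Schwarz[OF tch torus_continuous_mono2, of i j] by (simp add: proj)
    also have "\<dots> \<le> E M * nrm (mono2 i j)"
      unfolding E_def
      by (intro mult_right_mono truncation_bound[OF g orth h(1) proj] nrm_nonneg torus_continuous_mono2)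
    finally show ?thesis .
  qed
  then have "cmod (ip g (mono2 i j)) \<le> 0"
    by (intro LIMSEQ_le_const[OF lim]) blast
  then show ?thesis by simp
qed

text \<open>For k >= 1 a factor z is removed from both arguments. The remaining case k = 0 is
  reached through z g being orthogonal to every w^l p with l >= 1: in the expansion of p all terms
  of positive z-degree drop out.\<close>

lemma shift_orth:
  assumes g: "g \<in> mono_span ({0..<n} \<times> {0..m})"
    and orth: "\<And>i j. i < n \<Longrightarrow> 1 \<le> j \<Longrightarrow> j \<le> m \<Longrightarrow> ip g (mono2 i j) = 0"
    and "k \<le> n" "1 \<le> l"
  shows "ip (\<lambda>z w. z * g z w) (mono2 k l) = 0"
proof -
  have tcg: "torus_continuous g" by (rule torus_continuous_mono_span[OF g])
  have tczg: "torus_continuous (\<lambda>z w. z * g z w)" by (intro torus_continuous_intros tcg)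
  have pos: "ip (\<lambda>z w. z * g z w) (mono2 k l) = 0" if "1 \<le> k" "k \<le> n" "1 \<le> l" for k l
  proof -
    have "mono2 k l = (\<lambda>z w. z * mono2 (k - 1) l z w)"
      using that by (simp add: fun_eq_iff flip: power_Suc mult.assoc)
    then have "ip (\<lambda>z w. z * g z w) (mono2 k l) = ip g (mono2 (k - 1) l)"
      by (simp only:) (rule ip_unimodular, simp)
    then show ?thesis using orth_all_powers[OF g orth] that by simp
  qed
  \<comment> \<open>The offset \<open>Suc l\<close> starts the sequence at w^1, keeping the whole
    recurrence in the range where \<open>pos\<close> applies.\<close>
  define x where "x l = ip (\<lambda>z w. z * g z w) (mono2 0 (Suc l))" for l
  \<comment> \<open>The second argument of \<open>ip\<close> is conjugate-linear, hence the
    conjugated coefficients of p(0, w). Accordingly \<open>poly q r\<close> is the conjugate of p at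
    (0, \<open>cnj r\<close>), nonzero by stability.\<close>
  define q where "q = (\<Sum>t\<le>m. monom (cnj (c 0 t)) t)"
  have q: "coeff q t = (if t \<le> m then cnj (c 0 t) else 0)" for t
    by (simp add: q_def coeff_sum)
  have "x l = 0" for l
  proof (rule bounded_recurrence_zero)
    show "degree q \<le> m" by (rule degree_le) (simp add: q)
    show "poly q r \<noteq> 0" if "cmod r \<le> 1" for r
    proof -
      have p0: "p 0 u = (\<Sum>j\<le>m. c 0 j * u ^ j)" for u
        using sum.atMost_shift[of "\<lambda>i. \<Sum>j\<le>m. c i j * 0 ^ i * u ^ j" n] by (simp add: bipoly_def)
      have "poly q r = cnj (p 0 (cnj r))"
        unfolding p0 q_def by (simp add: poly_sum poly_monom)
      moreover have "p 0 (cnj r) \<noteq> 0" by (rule p_nonzero) (use that in simp_all)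
      ultimately show ?thesis by (simp only: complex_cnj_zero_iff not_False_eq_True)
    qed
    show "cmod (x l) \<le> nrm (\<lambda>z w. z * g z w) * nrm (mono2 0 0)" for l
    proof -
      have "nrm (mono2 0 (Suc l)) = nrm (mono2 0 0)"
        unfolding nrm_def using ip_unimodular[of "\<lambda>z w. w ^ Suc l" "\<lambda>z w. 1" "\<lambda>z w. 1"]
        by (simp add: norm_power del: power_Suc)
      then show ?thesis
        using Cauchy_Schwarz[OF tczg torus_continuous_mono2, of 0 "Suc l"] by (simp add: x_def)
    qed
    show "(\<Sum>t\<le>m. coeff q t * x (l + t)) = 0" for l
    proof -
      have tcp: "torus_continuous (\<lambda>z w. mono2 0 (Suc l) z w * p z w)"
        by (intro torus_continuous_intros weight_continuous)
      have "(\<lambda>z w. z ^ 1 * w ^ 0 * g z w) \<in> mono_span ({1..n} \<times> {0..m})"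
        by (rule mono_span_shift[OF g]) auto
      \<comment> \<open>Positive z-degree throughout is what makes each pairing with w^(l+1) p an
        \<open>alpha\<close> with positive first index.\<close>
      then have zg: "(\<lambda>z w. z * g z w) \<in> mono_span ({1..n} \<times> {0..m})" by simp
      have "ip (mono2 i j) (\<lambda>z w. mono2 0 (Suc l) z w * p z w) = 0" if "(i, j) \<in> {1..n} \<times> {0..m}" for i j
        unfolding ip_mono_p using that by (intro alpha_zero) auto
      then have "ip (\<lambda>z w. z * g z w) (\<lambda>z w. mono2 0 (Suc l) z w * p z w) = 0"
        by (rule ip_span_zero[OF zg tcp])
      moreover have "(\<lambda>z w. mono2 0 (Suc l) z w * p z w)
          = (\<lambda>z w. \<Sum>y\<in>{..n} \<times> {..m}. c (fst y) (snd y) * mono2 (fst y) (Suc (l + snd y)) z w)"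
        by (simp add: fun_eq_iff bipoly_def sum.cartesian_product case_prod_unfold sum_distrib_left power_add mult_ac)
      ultimately have "0 = ip (\<lambda>z w. z * g z w)
          (\<lambda>z w. \<Sum>y\<in>{..n} \<times> {..m}. c (fst y) (snd y) * mono2 (fst y) (Suc (l + snd y)) z w)"
        by (simp only:)
      also have "\<dots> = (\<Sum>y\<in>{..n} \<times> {..m}. cnj (c (fst y) (snd y)) *
          ip (\<lambda>z w. z * g z w) (mono2 (fst y) (Suc (l + snd y))))"
        by (intro ip_sum_right torus_continuous_mono2 tczg)
      also have "\<dots> = (\<Sum>y\<in>{0} \<times> {..m}. cnj (c (fst y) (snd y)) *
          ip (\<lambda>z w. z * g z w) (mono2 (fst y) (Suc (l + snd y))))"
      proof (rule sum.mono_neutral_right)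
        show "\<forall>y\<in>{..n} \<times> {..m} - {0} \<times> {..m}. cnj (c (fst y) (snd y)) *
            ip (\<lambda>z w. z * g z w) (mono2 (fst y) (Suc (l + snd y))) = 0"
        proof
          fix y assume "y \<in> {..n} \<times> {..m} - {0} \<times> {..m}"
          then have "1 \<le> fst y" "fst y \<le> n" by auto
          then show "cnj (c (fst y) (snd y)) * ip (\<lambda>z w. z * g z w) (mono2 (fst y) (Suc (l + snd y))) = 0"
            using pos[of "fst y" "Suc (l + snd y)"] by (simp del: power_Suc)
        qed
      qed auto
      also have "\<dots> = (\<Sum>t\<le>m. coeff q t * x (l + t))"
        by (rule sum.reindex_bij_witness[of _ "\<lambda>t. (0, t)" snd]) (auto simp: q x_def)
      finally show ?thesis by simp
    qed
  qed
  then have "ip (\<lambda>z w. z * g z w) (mono2 0 l) = 0"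
    using assms(4) x_def[of "l - 1"] by simp
  then show ?thesis using pos[of k l] assms(3,4) by (cases "k = 0") auto
qed

text \<open>Reflection exchanges orthogonality to j < m with orthogonality to j >= 1, and the
  missing exponent k = n with the exponent 0 handled by \<open>shift_orth\<close>.\<close>

lemma reflected_orth:
  assumes f: "f \<in> mono_span ({0..<n} \<times> {0..m})"
    and orth: "\<And>i j. i < n \<Longrightarrow> j < m \<Longrightarrow> ip (mono2 i j) f = 0"
    and "k \<le> n" "l < m"
  shows "ip (mono2 k l) f = 0"
proof -
  let ?A = "{0..<n} \<times> {0..m}"
  obtain a where a: "f = (\<lambda>z w. \<Sum>x\<in>?A. a x * mono2 (fst x) (snd x) z w)"
    using f unfolding mono_span_iff by blast
  \<comment> \<open>Reflection at bidegree (n - 1, m), written out on coefficients so that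
    \<open>g\<close> is a polynomial. The factor z in z g then makes up the reflection of f at
    bidegree (n, m).\<close>
  define g where "g = (\<lambda>z w. \<Sum>x\<in>?A. cnj (a x) * mono2 (n - 1 - fst x) (m - snd x) z w)"
  have gA: "g \<in> mono_span ?A"
    unfolding g_def using n_pos by (intro mono_span_sum mono_span_scale mono_span_mono2) auto
  have g: "g z w = mono2 (n - 1) m z w * cnj (f z w)" if "cmod z = 1" "cmod w = 1" for z w
  proof -
    have "z \<noteq> 0" "w \<noteq> 0" using that by auto
    have "g z w = (\<Sum>x\<in>?A. mono2 (n - 1) m z w * (cnj (a x) * cnj (mono2 (fst x) (snd x) z w)))"
      unfolding g_def
    proof (rule sum.cong, goal_cases)
      case (2 x)
      then have "fst x \<le> n - 1" "snd x \<le> m" by auto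
      note diff = power_diff[OF \<open>z \<noteq> 0\<close> this(1)] power_diff[OF \<open>w \<noteq> 0\<close> this(2)]
      show ?case
        unfolding diff by (simp add: cnj_unimodular that power_inverse divide_inverse mult_ac)
    qed simp
    then show ?thesis by (simp add: a sum_distrib_left)
  qed
  have "ip g (mono2 i j) = 0" if "i < n" "1 \<le> j" "j \<le> m" for i j
    using ip_reflect[of g "n - 1" m f "n - 1 - i" "m - j"] g orth[of "n - 1 - i" "m - j"] that by simp
  then have "ip (\<lambda>z w. z * g z w) (mono2 (n - k) (m - l)) = 0"
    using assms(4) by (intro shift_orth[OF gA]) auto
  moreover have "ip (\<lambda>z w. z * g z w) (mono2 (n - k) (m - l)) = ip (mono2 k l) f"
  proof (rule ip_reflect)
    show "z * g z w = mono2 n m z w * cnj (f z w)" if "cmod z = 1" "cmod w = 1" for z w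
      using g[OF that] n_pos by (simp flip: power_Suc mult.assoc)
  qed (use assms in auto)
  ultimately show ?thesis by simp
qed

section \<open>Comparison of the two reproducing kernels\<close>

abbreviation "H1 \<equiv> orth_compl ip (mono_span ({0..n} \<times> {0..<m})) (mono_span ({0..<n} \<times> {0..<m}))"
abbreviation "H2 \<equiv> orth_compl ip (mono_span ({0..<n} \<times> {0..m})) (mono_span ({0..<n} \<times> {1..m}))"
abbreviation "V \<equiv> orth_compl ip (mono_span ({0..n} \<times> {0..m})) (mono_span ({0..<n} \<times> {1..m}))"

text \<open>Subtracting from u its projection to P(n-1,m-1), to which e is orthogonal, leaves a
  polynomial to which \<open>reflected_orth\<close> applies; it is then orthogonal to all monomials
  of e. The result covers H2 and w P(n-1,m-1) at once.\<close>

lemma H1_orth: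
  assumes "e \<in> H1" "u \<in> mono_span ({0..<n} \<times> {0..m})"
  shows "ip e u = 0"
proof -
  have e: "e \<in> mono_span ({0..n} \<times> {0..<m})" "\<And>u. u \<in> mono_span ({0..<n} \<times> {0..<m}) \<Longrightarrow> ip e u = 0"
    using assms(1) by (simp_all add: orth_compl_iff)
  note tc = torus_continuous_mono_span
  obtain h where h: "h \<in> mono_span ({0..<n} \<times> {0..<m})"
    "\<And>v. v \<in> mono_span ({0..<n} \<times> {0..<m}) \<Longrightarrow> ip (\<lambda>z w. u z w - h z w) v = 0"
    using projection_exists[OF _ tc[OF assms(2)], of "{0..<n} \<times> {0..<m}"] by auto
  have "h \<in> mono_span ({0..<n} \<times> {0..m})" by (rule mono_span_subset[OF h(1)]) auto
  then have uh: "(\<lambda>z w. u z w - h z w) \<in> mono_span ({0..<n} \<times> {0..m})"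
    by (intro mono_span_diff assms(2))
  have "ip (mono2 i j) (\<lambda>z w. u z w - h z w) = 0" if "i < n" "j < m" for i j
    using that by (subst ip_sym_zero, intro h(2) mono_span_mono2) auto
  then have "ip (mono2 k l) (\<lambda>z w. u z w - h z w) = 0" if "k \<le> n" "l < m" for k l
    using reflected_orth[OF uh] that by blast
  then have "ip e (\<lambda>z w. u z w - h z w) = 0"
    by (intro ip_span_zero[OF e(1) tc[OF uh]]) auto
  moreover have "ip e (\<lambda>z w. u z w - h z w) = ip e u - ip e h"
    by (intro ip_diff_right tc[OF assms(2)] tc[OF h(1)] tc[OF e(1)])
  ultimately show ?thesis using e(2)[OF h(1)] by simp
qed

text \<open>The range of u contains both w H1 and w P(n-1,m-1), so one statement serves the
  orthogonality of the summands and their membership in \<open>V\<close>.\<close>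

lemma H2_shift_orth:
  assumes "g \<in> H2" "u \<in> mono_span ({0..n} \<times> {1..m})"
  shows "ip (\<lambda>z w. z * g z w) u = 0"
proof (rule ip_span_zero_right[OF assms(2)])
  have g: "g \<in> mono_span ({0..<n} \<times> {0..m})" "\<And>u. u \<in> mono_span ({0..<n} \<times> {1..m}) \<Longrightarrow> ip g u = 0"
    using assms(1) by (simp_all add: orth_compl_iff)
  show "torus_continuous (\<lambda>z w. z * g z w)"
    by (intro torus_continuous_intros torus_continuous_mono_span[OF g(1)])
  have "ip g (mono2 i j) = 0" if "i < n" "1 \<le> j" "j \<le> m" for i j
    using that by (intro g(2) mono_span_mono2) auto
  then show "ip (\<lambda>z w. z * g z w) (mono2 k l) = 0" if "(k, l) \<in> {0..n} \<times> {1..m}" for k l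
    using shift_orth[OF g(1)] that by auto
qed

section \<open>Spanning: the two decompositions of V\<close>

lemma pt_orth:
  assumes "u \<in> mono_span A" "\<And>i j. (i, j) \<in> A \<Longrightarrow> i < n \<or> j < m"
  shows "ip u pt = 0"
  using assms(2) by (intro ip_span_zero[OF assms(1)] torus_continuous_mono_span[OF pt_span] ip_pt_orth)

lemma p_orth:
  assumes "u \<in> mono_span A" "\<And>i j. (i, j) \<in> A \<Longrightarrow> 0 < i \<or> 0 < j"
  shows "ip u p = 0"
  using assms(2) by (intro ip_span_zero[OF assms(1)] weight_continuous ip_p_orth)

text \<open>If the (i, j) coefficient of g were 0, then g would be orthogonal to itself. Hence a
  multiple of g can cancel that monomial in f while remaining orthogonal to all the others.\<close>

lemma remove_multiple:
  assumes g: "g \<in> mono_span ({0..n} \<times> {0..m})" "ip g g = 1" and ij: "(i, j) \<in> {0..n} \<times> {0..m}"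
    and orth: "\<And>u. u \<in> mono_span ({0..n} \<times> {0..m} - {(i, j)}) \<Longrightarrow> ip u g = 0"
    and f: "f \<in> mono_span ({0..n} \<times> {0..m})"
  obtains a where "(\<lambda>z w. f z w - a * g z w) \<in> mono_span ({0..n} \<times> {0..m} - {(i, j)})"
proof -
  obtain a where a: "(\<lambda>z w. f z w - a * mono2 i j z w) \<in> mono_span ({0..n} \<times> {0..m} - {(i, j)})"
    using mono_span_remove[OF f _ ij] by auto
  obtain b where b: "(\<lambda>z w. g z w - b * mono2 i j z w) \<in> mono_span ({0..n} \<times> {0..m} - {(i, j)})"
    using mono_span_remove[OF g(1) _ ij] by auto
  have "b \<noteq> 0" using orth[OF b] g(2) by auto
  then have "(\<lambda>z w. f z w - (a / b) * g z w)
      = (\<lambda>z w. (f z w - a * mono2 i j z w) - (a / b) * (g z w - b * mono2 i j z w))"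
    by (simp add: fun_eq_iff algebra_simps)
  also have "\<dots> \<in> mono_span ({0..n} \<times> {0..m} - {(i, j)})"
    by (intro mono_span_diff[OF a mono_span_scale[OF b]])
  finally show ?thesis using that by blast
qed

lemma H1_projection:
  assumes "u \<in> mono_span ({0..n} \<times> {0..<m})"
  obtains h where "h \<in> H1" "(\<lambda>z w. u z w - h z w) \<in> mono_span ({0..<n} \<times> {0..<m})"
proof -
  obtain v where v: "v \<in> mono_span ({0..<n} \<times> {0..<m})"
    "\<And>x. x \<in> mono_span ({0..<n} \<times> {0..<m}) \<Longrightarrow> ip (\<lambda>z w. u z w - v z w) x = 0"
    using projection_exists[OF _ torus_continuous_mono_span[OF assms], of "{0..<n} \<times> {0..<m}"] by auto
  have "v \<in> mono_span ({0..n} \<times> {0..<m})" by (rule mono_span_subset[OF v(1)]) auto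
  then have "(\<lambda>z w. u z w - v z w) \<in> H1"
    using v(2) mono_span_diff[OF assms] by (simp add: orth_compl_iff)
  then show ?thesis using that v(1) by simp
qed

lemma H2_projection:
  assumes "u \<in> mono_span ({0..<n} \<times> {0..m})"
  obtains h where "h \<in> H2" "(\<lambda>z w. u z w - h z w) \<in> mono_span ({0..<n} \<times> {1..m})"
proof -
  obtain v where v: "v \<in> mono_span ({0..<n} \<times> {1..m})"
    "\<And>x. x \<in> mono_span ({0..<n} \<times> {1..m}) \<Longrightarrow> ip (\<lambda>z w. u z w - v z w) x = 0"
    using projection_exists[OF _ torus_continuous_mono_span[OF assms], of "{0..<n} \<times> {1..m}"] by auto
  have "v \<in> mono_span ({0..<n} \<times> {0..m})" by (rule mono_span_subset[OF v(1)]) auto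
  then have "(\<lambda>z w. u z w - v z w) \<in> H2"
    using v(2) mono_span_diff[OF assms] by (simp add: orth_compl_iff)
  then show ?thesis using that v(1) by simp
qed

lemma mono_span_orth_self:
  assumes "f \<in> mono_span A" "finite A" "\<And>u. u \<in> mono_span A \<Longrightarrow> ip f u = 0"
  shows "f z w = 0"
  using mono_span_definite[OF assms(1,2) assms(3)[OF assms(1)]] by simp

lemma H1_span: "h \<in> H1 \<Longrightarrow> h \<in> mono_span ({0..n} \<times> {0..m})"
  by (auto simp: orth_compl_iff intro: mono_span_subset)

lemma H2_span: "h \<in> H2 \<Longrightarrow> h \<in> mono_span ({0..n} \<times> {0..m})"
  by (auto simp: orth_compl_iff intro: mono_span_subset)

text \<open>Successive projection: \<open>pt\<close> removes z^n w^m, the rest splits between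
  P(n,m-1) and P(n-1,m), and each projection error is passed on to the next space.\<close>

lemma V_decomp_refl:
  assumes "f \<in> V"
  obtains a h1 h2 where "h1 \<in> H1" "h2 \<in> H2" "f = (\<lambda>z w. a * pt z w + h1 z w + h2 z w)"
proof -
  let ?S = "{0..n} \<times> {0..m}" and ?W = "{0..<n} \<times> {1..m}"
  note tc = torus_continuous_mono_span
  have f: "f \<in> mono_span ?S" "\<And>u. u \<in> mono_span ?W \<Longrightarrow> ip f u = 0"
    using assms by (simp_all add: orth_compl_iff)
  obtain a where a: "(\<lambda>z w. f z w - a * pt z w) \<in> mono_span (?S - {(n, m)})"
    by (rule remove_multiple[OF pt_span ip_pt_self _ _ f(1), of n m]) (auto intro: pt_orth)
  have "?S - {(n, m)} = {0..n} \<times> {0..<m} \<union> {0..<n} \<times> {0..m}" by auto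
  then have "(\<lambda>z w. f z w - a * pt z w) \<in> mono_span ({0..n} \<times> {0..<m} \<union> {0..<n} \<times> {0..m})"
    using a by (simp only:)
  then obtain u v where u: "u \<in> mono_span ({0..n} \<times> {0..<m})" and v: "v \<in> mono_span ({0..<n} \<times> {0..m})"
    and uv: "(\<lambda>z w. f z w - a * pt z w) = (\<lambda>z w. u z w + v z w)"
    by (rule mono_span_Un) simp_all
  obtain h1 where h1: "h1 \<in> H1" "(\<lambda>z w. u z w - h1 z w) \<in> mono_span ({0..<n} \<times> {0..<m})"
    using H1_projection[OF u] .
  \<comment> \<open>The error of the H1 projection has bidegree at most (n-1, m-1) and is absorbed
    into the part to be projected onto H2.\<close>
  have "(\<lambda>z w. u z w - h1 z w) \<in> mono_span ({0..<n} \<times> {0..m})"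
    by (rule mono_span_subset[OF h1(2)]) auto
  then have "(\<lambda>z w. (u z w - h1 z w) + v z w) \<in> mono_span ({0..<n} \<times> {0..m})"
    using v by (rule mono_span_add)
  then obtain h2 where h2: "h2 \<in> H2"
    "(\<lambda>z w. ((u z w - h1 z w) + v z w) - h2 z w) \<in> mono_span ?W"
    by (rule H2_projection)
  have uvf: "u z w + v z w = f z w - a * pt z w" for z w
    using uv by (simp add: fun_eq_iff)
  then have rest_eq: "((u z w - h1 z w) + v z w) - h2 z w = f z w - (a * pt z w + h1 z w + h2 z w)" for z w
    using uvf[of z w] by (simp add: algebra_simps)
  have rest: "(\<lambda>z w. f z w - (a * pt z w + h1 z w + h2 z w)) \<in> mono_span ?W"
    using h2(2) unfolding rest_eq .
  \<comment> \<open>The final error lies in w P(n-1,m-1), and every term forming it is orthogonal to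
    that space.\<close>
  have "f z w - (a * pt z w + h1 z w + h2 z w) = 0" for z w
  proof (rule mono_span_orth_self[OF rest])
    fix x assume x: "x \<in> mono_span ?W"
    have "x \<in> mono_span ({0..<n} \<times> {0..m})" by (rule mono_span_subset[OF x]) auto
    then have "ip h1 x = 0" by (rule H1_orth[OF h1(1)])
    moreover have "ip h2 x = 0" using h2(1) x by (simp add: orth_compl_iff)
    moreover have "ip pt x = 0" by (subst ip_sym_zero, rule pt_orth[OF x]) auto
    ultimately show "ip (\<lambda>z w. f z w - (a * pt z w + h1 z w + h2 z w)) x = 0"
      by (intro ip_combination_zero f(2)[OF x] tc[OF f(1)] tc[OF pt_span] tc[OF H1_span[OF h1(1)]]
          tc[OF H2_span[OF h2(1)]] tc[OF x])
  qed simp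
  then have "f = (\<lambda>z w. a * pt z w + h1 z w + h2 z w)" by (simp add: fun_eq_iff)
  then show ?thesis by (rule that[OF h1(1) h2(1)])
qed

lemma ip_w_shift: "ip (\<lambda>z w. w * f z w) (\<lambda>z w. w * g z w) = ip f g"
  and ip_z_shift: "ip (\<lambda>z w. z * f z w) (\<lambda>z w. z * g z w) = ip f g"
  by (rule ip_unimodular, simp)+

lemma H1_w_shift_orth:
  assumes "h \<in> H1" "x \<in> mono_span ({0..<n} \<times> {1..m})"
  shows "ip (\<lambda>z w. w * h z w) x = 0"
proof -
  obtain y where y: "y \<in> mono_span ({0..<n} \<times> {0..<m})" "x = (\<lambda>z w. mono2 0 1 z w * y z w)"
    by (rule mono_span_unshift[OF assms(2), of "{0..<n} \<times> {0..<m}" 0 1]) auto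
  have "ip (\<lambda>z w. w * h z w) x = ip h y"
    using ip_w_shift[of h y] by (simp add: y(2))
  then show ?thesis using assms(1) y(1) by (simp add: orth_compl_iff)
qed

text \<open>Here p removes the constant term and the rest splits into a multiple of z and a multiple
  of w. The H2 projection comes first, because its error is divisible by w.\<close>

lemma V_decomp:
  assumes "f \<in> V"
  obtains a h1 h2 where "h1 \<in> H1" "h2 \<in> H2" "f = (\<lambda>z w. a * p z w + w * h1 z w + z * h2 z w)"
proof -
  let ?S = "{0..n} \<times> {0..m}" and ?W = "{0..<n} \<times> {1..m}"
  note tc = torus_continuous_mono_span
  have f: "f \<in> mono_span ?S" "\<And>u. u \<in> mono_span ?W \<Longrightarrow> ip f u = 0"
    using assms by (simp_all add: orth_compl_iff)
  obtain a where a: "(\<lambda>z w. f z w - a * p z w) \<in> mono_span (?S - {(0, 0)})"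
    by (rule remove_multiple[OF p_span ip_p_self _ _ f(1), of 0 0]) (auto intro: p_orth)
  have "?S - {(0, 0)} = {1..n} \<times> {0..m} \<union> {0..n} \<times> {1..m}" by (auto simp: Suc_le_eq)
  then have "(\<lambda>z w. f z w - a * p z w) \<in> mono_span ({1..n} \<times> {0..m} \<union> {0..n} \<times> {1..m})"
    using a by (simp only:)
  then obtain u v where u: "u \<in> mono_span ({1..n} \<times> {0..m})" and v: "v \<in> mono_span ({0..n} \<times> {1..m})"
    and uv: "(\<lambda>z w. f z w - a * p z w) = (\<lambda>z w. u z w + v z w)"
    by (rule mono_span_Un) simp_all
  obtain u' where u': "u' \<in> mono_span ({0..<n} \<times> {0..m})" "u = (\<lambda>z w. mono2 1 0 z w * u' z w)"
    by (rule mono_span_unshift[OF u, of "{0..<n} \<times> {0..m}" 1 0]) auto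
  obtain h2 where h2: "h2 \<in> H2" "(\<lambda>z w. u' z w - h2 z w) \<in> mono_span ?W"
    using H2_projection[OF u'(1)] .
  \<comment> \<open>The error of the H2 projection has w-degree at least 1 and keeps it after
    multiplication by z, so it joins the part divisible by w.\<close>
  have "(\<lambda>z w. z ^ 1 * w ^ 0 * (u' z w - h2 z w)) \<in> mono_span ({0..n} \<times> {1..m})"
    by (rule mono_span_shift[OF h2(2)]) auto
  then have "(\<lambda>z w. z * (u' z w - h2 z w) + v z w) \<in> mono_span ({0..n} \<times> {1..m})"
    using mono_span_add[OF _ v] by simp
  then obtain v' where v': "v' \<in> mono_span ({0..n} \<times> {0..<m})"
    "(\<lambda>z w. z * (u' z w - h2 z w) + v z w) = (\<lambda>z w. mono2 0 1 z w * v' z w)"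
    by (rule mono_span_unshift[of _ _ "{0..n} \<times> {0..<m}" 0 1]) auto
  obtain h1 where h1: "h1 \<in> H1" "(\<lambda>z w. v' z w - h1 z w) \<in> mono_span ({0..<n} \<times> {0..<m})"
    using H1_projection[OF v'(1)] .
  have w_rest: "(\<lambda>z w. z ^ 0 * w ^ 1 * (v' z w - h1 z w)) \<in> mono_span ?W"
    by (rule mono_span_shift[OF h1(2)]) auto
  have eq: "z ^ 0 * w ^ 1 * (v' z w - h1 z w) = f z w - (a * p z w + w * h1 z w + z * h2 z w)" for z w
  proof -
    have "f z w - a * p z w = z * u' z w + v z w" "z * (u' z w - h2 z w) + v z w = w * v' z w"
      using fun_cong[OF fun_cong[OF uv], of z w] fun_cong[OF fun_cong[OF v'(2)], of z w] by (simp_all add: u'(2))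
    then show ?thesis by (simp add: algebra_simps)
  qed
  have rest: "(\<lambda>z w. f z w - (a * p z w + w * h1 z w + z * h2 z w)) \<in> mono_span ?W"
    using w_rest unfolding eq .
  have "f z w - (a * p z w + w * h1 z w + z * h2 z w) = 0" for z w
  proof (rule mono_span_orth_self[OF rest])
    fix x assume x: "x \<in> mono_span ?W"
    have "x \<in> mono_span ({0..n} \<times> {1..m})" by (rule mono_span_subset[OF x]) auto
    then have "ip (\<lambda>z w. z * h2 z w) x = 0" by (rule H2_shift_orth[OF h2(1)])
    moreover have "ip (\<lambda>z w. w * h1 z w) x = 0" by (rule H1_w_shift_orth[OF h1(1) x])
    moreover have "ip p x = 0" by (subst ip_sym_zero, rule p_orth[OF x]) auto
    ultimately show "ip (\<lambda>z w. f z w - (a * p z w + w * h1 z w + z * h2 z w)) x = 0"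
      by (intro ip_combination_zero f(2)[OF x] tc[OF f(1)] weight_continuous tc[OF x]
          torus_continuous_mult torus_continuous_fst torus_continuous_snd
          tc[OF H1_span[OF h1(1)]] tc[OF H2_span[OF h2(1)]])
  qed simp
  then have "f = (\<lambda>z w. a * p z w + w * h1 z w + z * h2 z w)" by (simp add: fun_eq_iff)
  then show ?thesis by (rule that[OF h1(1) h2(1)])
qed

section \<open>Orthogonality of the summands and membership in V\<close>

lemma ip_decomp_refl:
  assumes "h1 \<in> H1" "h2 \<in> H2" "h1' \<in> H1" "h2' \<in> H2"
  shows "ip (\<lambda>z w. a * pt z w + h1 z w + h2 z w) (\<lambda>z w. a' * pt z w + h1' z w + h2' z w)
    = a * cnj a' + ip h1 h1' + ip h2 h2'"
proof -
  note tc = torus_continuous_mono_span[OF H1_span[OF assms(1)]] torus_continuous_mono_span[OF H2_span[OF assms(2)]]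
    torus_continuous_mono_span[OF H1_span[OF assms(3)]] torus_continuous_mono_span[OF H2_span[OF assms(4)]]
  have apt: "torus_continuous (\<lambda>z w. b * pt z w)" for b
    by (intro torus_continuous_intros torus_continuous_mono_span[OF pt_span])
  have H2m: "h \<in> mono_span ({0..<n} \<times> {0..m})" if "h \<in> H2" for h
    using that by (simp add: orth_compl_iff)
  have h1: "ip h pt = 0" "ip pt h = 0" if "h \<in> H1" for h
  proof -
    have "h \<in> mono_span ({0..n} \<times> {0..<m})" using that by (simp add: orth_compl_iff)
    then show "ip h pt = 0" by (rule pt_orth) simp
    then show "ip pt h = 0" by (simp add: ip_sym_zero[of pt])
  qed
  have h2: "ip h pt = 0" "ip pt h = 0" if "h \<in> H2" for h
  proof -
    show "ip h pt = 0" by (rule pt_orth[OF H2m[OF that]]) simp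
    then show "ip pt h = 0" by (simp add: ip_sym_zero[of pt])
  qed
  have "ip h1 h2' = 0" "ip h1' h2 = 0"
    using H1_orth[OF assms(1) H2m[OF assms(4)]] H1_orth[OF assms(3) H2m[OF assms(2)]] by auto
  then have "ip (\<lambda>z w. a * pt z w + h1 z w + h2 z w) (\<lambda>z w. a' * pt z w + h1' z w + h2' z w)
      = ip (\<lambda>z w. a * pt z w) (\<lambda>z w. a' * pt z w) + ip h1 h1' + ip h2 h2'"
    using h1[OF assms(1)] h1[OF assms(3)] h2[OF assms(2)] h2[OF assms(4)] ip_sym_zero[of h1' h2]
    by (intro ip_orth3 apt tc) (simp_all add: ip_scale_left ip_scale_right)
  then show ?thesis by (simp add: ip_scale_left ip_scale_right ip_pt_self)
qed

lemma ip_decomp: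
  assumes "h1 \<in> H1" "h2 \<in> H2" "h1' \<in> H1" "h2' \<in> H2"
  shows "ip (\<lambda>z w. a * p z w + w * h1 z w + z * h2 z w) (\<lambda>z w. a' * p z w + w * h1' z w + z * h2' z w)
    = a * cnj a' + ip h1 h1' + ip h2 h2'"
proof -
  have tc1: "torus_continuous (\<lambda>z w. w * h z w)" if "h \<in> H1" for h
    by (intro torus_continuous_mult torus_continuous_snd torus_continuous_mono_span[OF H1_span[OF that]])
  have tc2: "torus_continuous (\<lambda>z w. z * h z w)" if "h \<in> H2" for h
    by (intro torus_continuous_mult torus_continuous_fst torus_continuous_mono_span[OF H2_span[OF that]])
  have ap: "torus_continuous (\<lambda>z w. b * p z w)" for b
    by (intro torus_continuous_mult torus_continuous_const weight_continuous)
  have span1: "(\<lambda>z w. w * h z w) \<in> mono_span ({0..n} \<times> {1..m})" if "h \<in> H1" for h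
  proof -
    have "h \<in> mono_span ({0..n} \<times> {0..<m})" using that by (simp add: orth_compl_iff)
    then have "(\<lambda>z w. z ^ 0 * w ^ 1 * h z w) \<in> mono_span ({0..n} \<times> {1..m})"
      by (rule mono_span_shift) auto
    then show ?thesis by simp
  qed
  have span2: "(\<lambda>z w. z * h z w) \<in> mono_span ({1..n} \<times> {0..m})" if "h \<in> H2" for h
  proof -
    have "h \<in> mono_span ({0..<n} \<times> {0..m})" using that by (simp add: orth_compl_iff)
    then have "(\<lambda>z w. z ^ 1 * w ^ 0 * h z w) \<in> mono_span ({1..n} \<times> {0..m})"
      by (rule mono_span_shift) auto
    then show ?thesis by simp
  qed
  have h1: "ip (\<lambda>z w. w * h z w) p = 0" "ip p (\<lambda>z w. w * h z w) = 0" if "h \<in> H1" for h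
  proof -
    show "ip (\<lambda>z w. w * h z w) p = 0" by (rule p_orth[OF span1[OF that]]) simp
    then show "ip p (\<lambda>z w. w * h z w) = 0" by (simp add: ip_sym_zero[of p])
  qed
  have h2: "ip (\<lambda>z w. z * h z w) p = 0" "ip p (\<lambda>z w. z * h z w) = 0" if "h \<in> H2" for h
  proof -
    show "ip (\<lambda>z w. z * h z w) p = 0" by (rule p_orth[OF span2[OF that]]) simp
    then show "ip p (\<lambda>z w. z * h z w) = 0" by (simp add: ip_sym_zero[of p])
  qed
  have h21: "ip (\<lambda>z w. z * h z w) (\<lambda>z w. w * h' z w) = 0" if "h \<in> H2" "h' \<in> H1" for h h'
    by (rule H2_shift_orth[OF that(1) span1[OF that(2)]])
  then have h12: "ip (\<lambda>z w. w * h' z w) (\<lambda>z w. z * h z w) = 0" if "h \<in> H2" "h' \<in> H1" for h h'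
    using that ip_sym_zero[of "\<lambda>z w. w * h' z w"] by simp
  have "ip (\<lambda>z w. a * p z w + w * h1 z w + z * h2 z w) (\<lambda>z w. a' * p z w + w * h1' z w + z * h2' z w)
      = ip (\<lambda>z w. a * p z w) (\<lambda>z w. a' * p z w) + ip (\<lambda>z w. w * h1 z w) (\<lambda>z w. w * h1' z w)
        + ip (\<lambda>z w. z * h2 z w) (\<lambda>z w. z * h2' z w)"
    using assms by (intro ip_orth3 ap tc1 tc2) (simp_all add: ip_scale_left ip_scale_right h1 h2 h12 h21)
  then show ?thesis by (simp add: ip_scale_left ip_scale_right ip_p_self ip_w_shift ip_z_shift)
qed

text \<open>The converse of the decomposition: it places the candidate kernel in \<open>V\<close>,
  as uniqueness of the reproducing kernel requires. \<open>V_shift\<close> does this for the other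
  candidate.\<close>

lemma V_refl:
  assumes "h1 \<in> H1" "h2 \<in> H2"
  shows "(\<lambda>z w. a * pt z w + h1 z w + h2 z w) \<in> V"
proof -
  note tc = torus_continuous_mono_span
  have "ip (\<lambda>z w. a * pt z w + h1 z w + h2 z w) x = 0" if x: "x \<in> mono_span ({0..<n} \<times> {1..m})" for x
  proof -
    have "x \<in> mono_span ({0..<n} \<times> {0..m})" by (rule mono_span_subset[OF x]) auto
    then have "ip h1 x = 0" by (rule H1_orth[OF assms(1)])
    moreover have "ip h2 x = 0" using assms(2) x by (simp add: orth_compl_iff)
    moreover have "ip pt x = 0" by (subst ip_sym_zero, rule pt_orth[OF x]) auto
    ultimately show ?thesis
      by (intro ip_sum3_zero tc[OF pt_span] tc[OF H1_span[OF assms(1)]] tc[OF H2_span[OF assms(2)]] tc[OF x])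
  qed
  then show ?thesis
    using mono_span_add[OF mono_span_add[OF mono_span_scale[OF pt_span] H1_span[OF assms(1)]] H2_span[OF assms(2)]]
    by (simp add: orth_compl_iff)
qed

lemma V_shift:
  assumes "h1 \<in> H1" "h2 \<in> H2"
  shows "(\<lambda>z w. a * p z w + w * h1 z w + z * h2 z w) \<in> V"
proof -
  note tc = torus_continuous_mono_span
  have h1: "(\<lambda>z w. w * h1 z w) \<in> mono_span ({0..n} \<times> {0..m})"
  proof -
    have "h1 \<in> mono_span ({0..n} \<times> {0..<m})" using assms(1) by (simp add: orth_compl_iff)
    then have "(\<lambda>z w. z ^ 0 * w ^ 1 * h1 z w) \<in> mono_span ({0..n} \<times> {0..m})"
      by (rule mono_span_shift) auto
    then show ?thesis by simp
  qed
  have h2: "(\<lambda>z w. z * h2 z w) \<in> mono_span ({0..n} \<times> {0..m})"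
  proof -
    have "h2 \<in> mono_span ({0..<n} \<times> {0..m})" using assms(2) by (simp add: orth_compl_iff)
    then have "(\<lambda>z w. z ^ 1 * w ^ 0 * h2 z w) \<in> mono_span ({0..n} \<times> {0..m})"
      by (rule mono_span_shift) auto
    then show ?thesis by simp
  qed
  have "ip (\<lambda>z w. a * p z w + w * h1 z w + z * h2 z w) x = 0" if x: "x \<in> mono_span ({0..<n} \<times> {1..m})" for x
  proof -
    have "x \<in> mono_span ({0..n} \<times> {1..m})" by (rule mono_span_subset[OF x]) auto
    then have "ip (\<lambda>z w. z * h2 z w) x = 0" by (rule H2_shift_orth[OF assms(2)])
    moreover have "ip (\<lambda>z w. w * h1 z w) x = 0" by (rule H1_w_shift_orth[OF assms(1) x])
    moreover have "ip p x = 0" by (subst ip_sym_zero, rule p_orth[OF x]) auto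
    ultimately show ?thesis
      by (intro ip_sum3_zero weight_continuous tc[OF h1] tc[OF h2] tc[OF x])
  qed
  then show ?thesis
    by (auto simp: orth_compl_iff intro!: mono_span_add mono_span_scale p_span h1 h2)
qed

text \<open>Both decompositions produce an element of \<open>V\<close> representing evaluation at
  (z1, w1). Equating the two and collecting the K1 and K2 terms gives the factors 1 - w
  \<open>cnj w1\<close> and 1 - z \<open>cnj z1\<close>.\<close>

theorem christoffel_darboux:
  assumes e1: "is_onb ip H1 e1" and e2: "is_onb ip H2 e2"
  shows "p z w * cnj (p z1 w1) - pt z w * cnj (pt z1 w1)
    = (1 - w * cnj w1) * repr_kernel e1 z w z1 w1 + (1 - z * cnj z1) * repr_kernel e2 z w z1 w1"
proof -
  define k1 where "k1 = (\<lambda>z w. repr_kernel e1 z w z1 w1)"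
  define k2 where "k2 = (\<lambda>z w. repr_kernel e2 z w z1 w1)"
  have k1: "k1 \<in> H1" unfolding k1_def by (rule repr_kernel_orth_compl[OF e1])
  have k2: "k2 \<in> H2" unfolding k2_def by (rule repr_kernel_orth_compl[OF e2])
  have r1: "ip h k1 = h z1 w1" if "h \<in> H1" for h
    unfolding k1_def by (rule ip_repr_kernel_reproducing[OF e1 _ that]) (auto simp: orth_compl_iff)
  have r2: "ip h k2 = h z1 w1" if "h \<in> H2" for h
    unfolding k2_def by (rule ip_repr_kernel_reproducing[OF e2 _ that]) (auto simp: orth_compl_iff)
  define A where "A = (\<lambda>z w. cnj (pt z1 w1) * pt z w + k1 z w + k2 z w)"
  \<comment> \<open>Since multiplication by w is isometric, w H1 has kernel w \<open>cnj w1\<close>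
    K1, and similarly for z H2.\<close>
  define B where "B = (\<lambda>z w. cnj (p z1 w1) * p z w + w * (cnj w1 * k1 z w) + z * (cnj z1 * k2 z w))"
  have k1': "(\<lambda>z w. cnj w1 * k1 z w) \<in> H1" and k2': "(\<lambda>z w. cnj z1 * k2 z w) \<in> H2"
    by (intro orth_compl_scale k1 k2)+
  have AV: "A \<in> V" and BV: "B \<in> V"
    unfolding A_def B_def by (intro V_refl V_shift k1 k2 k1' k2')+
  have fA: "ip f A = f z1 w1" if f: "f \<in> V" for f
  proof -
    obtain a h1 h2 where h: "h1 \<in> H1" "h2 \<in> H2" and f: "f = (\<lambda>z w. a * pt z w + h1 z w + h2 z w)"
      using V_decomp_refl[OF f] .
    show ?thesis unfolding A_def f ip_decomp_refl[OF h k1 k2] by (simp add: r1[OF h(1)] r2[OF h(2)])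
  qed
  have fB: "ip f B = f z1 w1" if f: "f \<in> V" for f
  proof -
    obtain a h1 h2 where h: "h1 \<in> H1" "h2 \<in> H2" and f: "f = (\<lambda>z w. a * p z w + w * h1 z w + z * h2 z w)"
      using V_decomp[OF f] .
    show ?thesis unfolding B_def f ip_decomp[OF h k1' k2'] by (simp add: r1[OF h(1)] r2[OF h(2)] ip_scale_right)
  qed
  have span: "A \<in> mono_span ({0..n} \<times> {0..m})" "B \<in> mono_span ({0..n} \<times> {0..m})"
    using AV BV by (simp_all add: orth_compl_iff)
  note tc = torus_continuous_mono_span[OF span(1)] torus_continuous_mono_span[OF span(2)]
  \<comment> \<open>Each of the four inner products is a value of A or B at (z1, w1), and these
    cancel in pairs.\<close>
  have "ip (\<lambda>z w. A z w - B z w) (\<lambda>z w. A z w - B z w) = 0"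
    using fA[OF AV] fA[OF BV] fB[OF AV] fB[OF BV] tc
    by (simp add: ip_diff_left ip_diff_right torus_continuous_diff)
  then have "(\<lambda>z w. A z w - B z w) = (\<lambda>z w. 0)"
    by (intro mono_span_definite[OF mono_span_diff[OF span]]) auto
  then have "A z w - B z w = 0" by (rule fun_cong[OF fun_cong])
  then show ?thesis
    by (simp add: A_def B_def k1_def k2_def algebra_simps)
qed

end

theorem mainTheorem10:
  fixes c :: "nat \<Rightarrow> nat \<Rightarrow> complex" and n m :: nat
    and e1 e2 :: "(complex \<Rightarrow> complex \<Rightarrow> complex) list"
  assumes "n \<ge> 1" and "m \<ge> 1"
    and "has_bidegree c n m"
    and "stable2 (bipoly c n m)"
    and "is_onb (ip_p (bipoly c n m))
           (orth_compl (ip_p (bipoly c n m))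
              (mono_span ({0..n} \<times> {0..<m})) (mono_span ({0..<n} \<times> {0..<m}))) e1"
    and "is_onb (ip_p (bipoly c n m))
           (orth_compl (ip_p (bipoly c n m))
              (mono_span ({0..<n} \<times> {0..m})) (mono_span ({0..<n} \<times> {1..m}))) e2"
  shows "\<forall>z w z1 w1.
    bipoly c n m z w * cnj (bipoly c n m z1 w1)
      - bipoly_refl c n m z w * cnj (bipoly_refl c n m z1 w1)
    = (1 - w * cnj w1) * repr_kernel e1 z w z1 w1
      + (1 - z * cnj z1) * repr_kernel e2 z w z1 w1"
proof -
  interpret stable_bipoly c n m using assms(1,2,4) by unfold_locales
  show ?thesis using christoffel_darboux[OF assms(5,6)] by blast
qed

end
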